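(* Let $X$ be a finite set and $\mathcal{R}\subseteq X\times X$ a symmetric reflexive relation on $X$, and suppose that $\mathcal{R}$ generates the full equivalence relation $X\times X$ (i.e. the graph corresponding to $\mathcal{R}$ is connected). Then: (1) the $C^*$-envelope of $E(\mathcal{R})$ is $C^*_{\mathrm{env}}(E(\mathcal{R}))=\mathcal{K}(\ell^2(X))$; (2) the propagation number is $\mathrm{prop}(E(\mathcal{R}))=\mathrm{diam}(\mathcal{R})$, the graph diameter of $\mathcal{R}$.
   Context: $\mathcal{K}(\ell^2(X))$ is the matrix $C^*$-algebra of all linear operators on $\ell^2(X)$, with matrix units $e_{xy}$. $E(\mathcal{R})\subseteq\mathcal{K}(\ell^2(X))$ is the unital operator system given by the linear span of the $e_{xy}$ with $(x,y)\in\mathcal{R}$. The relation $\mathcal{R}$ is viewed as a graph with vertex set $X$ and edges $xy$ for $(x,y)\in\mathcal{R}$; $\mathrm{diam}(\mathcal{R})$ is the maximum over pairs of vertices of the graph distance (length of a shortest path). A $C^*$-extension of a unital operator system $E$ is a unital complete order isomorphism $\kappa:E\to\kappa(E)\subseteq A$ onto its image in a $C^*$-algebra $A$ such that $\kappa(E)$ generates $A$ as a $C^*$-algebra. A $C^*$-envelope of $E$ is a $C^*$-extension $\imath_E:E\to C^*_{\mathrm{env}}(E)$ such that for every $C^*$-extension $\lambda:E\to B$ there is a unique $*$-homomorphism $\rho:B\to C^*_{\mathrm{env}}(E)$ with $\rho\circ\lambda=\imath_E$. Statement (1) means that the inclusion $E(\mathcal{R})\subseteq\mathcal{K}(\ell^2(X))$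 is the $C^*$-envelope. For an operator system $F$ in a $C^*$-algebra and an integer $n>0$, $F^{\circ n}$ denotes the norm closure of the linear span of products of $\leq n$ elements of $F$. The propagation number $\mathrm{prop}(E)$ is the smallest integer $n$ such that $\imath_E(E)^{\circ n}\subseteq C^*_{\mathrm{env}}(E)$ is a $C^*$-algebra ($\infty$ if there is none).
   Formalization: Part (2) is stated for sets X with at least two elements: for a one-point X one has E(R) = C with propagation number 1 (n > 0 is required), while the graph diameter is 0. *)

theory Defs
  imports "HOL-Analysis.Analysis" "HOL-Library.Extended_Nat"
begin

section \<open>Unital \<open>C\<^sup>*\<close>-algebras\<close>

text \<open>
  Unital \<open>C\<^sup>*\<close>-algebras over the complex numbers, with unit of norm one (that is, the zero
  algebra is excluded).  A \<open>C\<^sup>*\<close>-extension of a nonzero unital operator system is automatically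
  of this kind, since its embedding is unital and injective and its image generates.
\<close>

class cstar_algebra = banach + real_normed_algebra_1 +
  fixes scaleC :: "complex \<Rightarrow> 'a \<Rightarrow> 'a"  (infixr \<open>*\<^sub>C\<close> 75)
    and star :: "'a \<Rightarrow> 'a"
  assumes scaleC_add_right: "c *\<^sub>C (x + y) = c *\<^sub>C x + c *\<^sub>C y"
    and scaleC_add_left: "(c + d) *\<^sub>C x = c *\<^sub>C x + d *\<^sub>C x"
    and scaleC_scaleC: "c *\<^sub>C d *\<^sub>C x = (c * d) *\<^sub>C x"
    and scaleC_one: "1 *\<^sub>C x = x"
    and scaleR_scaleC: "r *\<^sub>R x = complex_of_real r *\<^sub>C x"
    and mult_scaleC_left: "(c *\<^sub>C x) * y = c *\<^sub>C (x * y)"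
    and mult_scaleC_right: "x * (c *\<^sub>C y) = c *\<^sub>C (x * y)"
    and norm_scaleC: "norm (c *\<^sub>C x) = cmod c * norm x"
    and star_star: "star (star x) = x"
    and star_add: "star (x + y) = star x + star y"
    and star_scaleC: "star (c *\<^sub>C x) = cnj c *\<^sub>C star x"
    and star_mult: "star (x * y) = star y * star x"
    and cstar_identity: "norm (star x * x) = (norm x)\<^sup>2"

lemma vector_space_scaleC:
  "vector_space (scaleC :: complex \<Rightarrow> 'a::cstar_algebra \<Rightarrow> 'a)"
  by standard (simp_all add: scaleC_add_right scaleC_add_left scaleC_scaleC scaleC_one)

abbreviation csubspace :: "'a::cstar_algebra set \<Rightarrow> bool"
  where "csubspace \<equiv> module.subspace scaleC"

abbreviation cspan :: "'a::cstar_algebra set \<Rightarrow> 'a set"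
  where "cspan \<equiv> module.span scaleC"

definition cstar_subalgebra :: "'a::cstar_algebra set \<Rightarrow> bool"
  where "cstar_subalgebra S \<longleftrightarrow>
    csubspace S \<and> closed S \<and> (\<forall>x\<in>S. \<forall>y\<in>S. x * y \<in> S) \<and> (\<forall>x\<in>S. star x \<in> S)"

definition star_homomorphism :: "('a::cstar_algebra \<Rightarrow> 'b::cstar_algebra) \<Rightarrow> bool"
  where "star_homomorphism \<rho> \<longleftrightarrow>
    (\<forall>x y. \<rho> (x + y) = \<rho> x + \<rho> y) \<and> (\<forall>c x. \<rho> (c *\<^sub>C x) = c *\<^sub>C \<rho> x) \<and>
    (\<forall>x y. \<rho> (x * y) = \<rho> x * \<rho> y) \<and> (\<forall>x. \<rho> (star x) = star (\<rho> x))"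


section \<open>Operator systems, \<open>C\<^sup>*\<close>-envelopes and the propagation number\<close>

definition operator_system :: "'a::cstar_algebra set \<Rightarrow> bool"
  where "operator_system E \<longleftrightarrow> csubspace E \<and> 1 \<in> E \<and> (\<forall>x\<in>E. star x \<in> E)"

text \<open>
  An \<open>n \<times> n\<close> matrix over an algebra is a function \<open>x\<close> of two indices, of which only the values
  \<open>x i j\<close> with \<open>i < n\<close> and \<open>j < n\<close> matter.  It is positive if it is of the form \<open>b\<^sup>* b\<close> in the
  \<open>C\<^sup>*\<close>-algebra of \<open>n \<times> n\<close> matrices.
\<close>

definition positive_matrix :: "nat \<Rightarrow> (nat \<Rightarrow> nat \<Rightarrow> 'a::cstar_algebra) \<Rightarrow> bool"
  where "positive_matrix n x \<longleftrightarrow>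
    (\<exists>b. \<forall>i<n. \<forall>j<n. x i j = (\<Sum>k<n. star (b k i) * b k j))"

text \<open>Only the values of \<open>\<kappa>\<close> on \<open>E\<close> matter here.\<close>

definition unital_complete_order_iso_on ::
    "'a::cstar_algebra set \<Rightarrow> ('a \<Rightarrow> 'b::cstar_algebra) \<Rightarrow> bool"
  where "unital_complete_order_iso_on E \<kappa> \<longleftrightarrow>
    (\<forall>x\<in>E. \<forall>y\<in>E. \<kappa> (x + y) = \<kappa> x + \<kappa> y) \<and>
    (\<forall>c. \<forall>x\<in>E. \<kappa> (c *\<^sub>C x) = c *\<^sub>C \<kappa> x) \<and>
    \<kappa> 1 = 1 \<and> inj_on \<kappa> E \<and>
    (\<forall>n x. (\<forall>i<n. \<forall>j<n. x i j \<in> E) \<longrightarrow>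
      (positive_matrix n x \<longleftrightarrow> positive_matrix n (\<lambda>i j. \<kappa> (x i j))))"

text \<open>The generated \<open>C\<^sup>*\<close>-algebra is the whole type \<open>'b\<close>.\<close>

definition cstar_extension :: "'a::cstar_algebra set \<Rightarrow> ('a \<Rightarrow> 'b::cstar_algebra) \<Rightarrow> bool"
  where "cstar_extension E \<kappa> \<longleftrightarrow>
    operator_system E \<and> unital_complete_order_iso_on E \<kappa> \<and>
    (cstar_subalgebra hull (\<kappa> ` E)) = UNIV"

text \<open>
  The universal property of a \<open>C\<^sup>*\<close>-envelope \<open>\<iota>\<close> into \<open>'c\<close>, tested against all \<open>C\<^sup>*\<close>-extensions
  into the \<open>C\<^sup>*\<close>-algebra \<open>'b\<close>.  HOL has no quantifier over types inside a formula, so \<open>'b\<close> is a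
  parameter: \<open>\<iota>\<close> is a \<open>C\<^sup>*\<close>-envelope of \<open>E\<close> if this holds for every type \<open>'b\<close> of class
  \<open>cstar_algebra\<close>.  In a conclusion, \<open>'b\<close> should therefore be left as a type variable; as a
  hypothesis, a single instance is weaker than the property itself.
\<close>

definition cstar_envelope ::
    "'b::cstar_algebra itself \<Rightarrow> 'a::cstar_algebra set \<Rightarrow> ('a \<Rightarrow> 'c::cstar_algebra) \<Rightarrow> bool"
  where "cstar_envelope (_ :: 'b itself) E \<iota> \<longleftrightarrow>
    cstar_extension E \<iota> \<and>
    (\<forall>\<kappa> :: 'a \<Rightarrow> 'b. cstar_extension E \<kappa> \<longrightarrow>
      (\<exists>!\<rho> :: 'b \<Rightarrow> 'c. star_homomorphism \<rho> \<and> (\<forall>x\<in>E. \<rho> (\<kappa> x) = \<iota> x)))"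

definition product_space :: "'a::cstar_algebra set \<Rightarrow> nat \<Rightarrow> 'a set"
  where "product_space F n =
    closure (cspan {prod_list xs |xs. xs \<noteq> [] \<and> length xs \<le> n \<and> set xs \<subseteq> F})"

text \<open>
  The propagation number of \<open>E\<close>, computed in a \<open>C\<^sup>*\<close>-envelope \<open>\<iota>\<close> of \<open>E\<close>.  The infimum of the
  empty set is \<open>\<infinity>\<close>.
\<close>

definition propagation_number ::
    "'a::cstar_algebra set \<Rightarrow> ('a \<Rightarrow> 'c::cstar_algebra) \<Rightarrow> enat"
  where "propagation_number E \<iota> =
    (INF n \<in> {n. 0 < n \<and> cstar_subalgebra (product_space (\<iota> ` E) n)}. enat n)"


section \<open>The matrix algebra \<open>K(\<ell>\<^sup>2(X))\<close> for finite \<open>X\<close>\<close>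

text \<open>
  The set \<open>X\<close> is the universe of the finite type \<open>'x\<close>, and \<open>complex ^ 'x\<close> with its Euclidean norm
  is \<open>\<ell>\<^sup>2(X)\<close>.  A new type is needed because the norm and the product already defined on
  \<open>complex ^ 'x ^ 'x\<close> are not those of the algebra of operators.
\<close>

typedef (overloaded) ('x::finite) ell2_op = "UNIV :: (complex ^ 'x ^ 'x) set"
  morphisms mat_of_op op_of_mat by simp

setup_lifting type_definition_ell2_op

definition conj_transpose :: "complex ^ 'm ^ 'n \<Rightarrow> complex ^ 'n ^ 'm"
  where "conj_transpose A = (\<chi> i j. cnj (A $ j $ i))"

lemma bl_mv [simp]: "bounded_linear ((*v) (A :: complex ^ 'x ^ 'x))"
  by (intro linear_conv_bounded_linear[THEN iffD1] linearI)
     (simp_all add: vec_eq_iff matrix_vector_mult_def ring_distribs sum.distrib scaleR_sum_right)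

lemma mat_eqI: "(\<And>v. A *v v = B *v v) \<Longrightarrow> A = (B :: complex ^ 'x ^ 'x)"
  by (simp add: matrix_eq)

lemma mv_fun:
  fixes A B :: "complex ^ 'x ^ 'x"
  shows "(*v) (A + B) = (\<lambda>v. A *v v + B *v v)"
    and "(*v) (r *\<^sub>R A) = (\<lambda>v. r *\<^sub>R (A *v v))"
    and "(*v) (mat 1 :: complex ^ 'x ^ 'x) = (\<lambda>v. v)"
    and "(*v) (\<chi> i j. c * A $ i $ j) = (\<lambda>v. c *s (A *v v))"
proof -
  show "(*v) (A + B) = (\<lambda>v. A *v v + B *v v)"
    by (rule ext) (rule matrix_vector_mult_add_rdistrib)
  show "(*v) (r *\<^sub>R A) = (\<lambda>v. r *\<^sub>R (A *v v))"
    by (rule ext) (simp add: vec_eq_iff matrix_vector_mult_def scaleR_sum_right)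
  show "(*v) (mat 1 :: complex ^ 'x ^ 'x) = (\<lambda>v. v)"
    by (rule ext) simp
  show "(*v) (\<chi> i j. c * A $ i $ j) = (\<lambda>v. c *s (A *v v))"
    by (rule ext) (simp add: vec_eq_iff matrix_vector_mult_def sum_distrib_left mult.assoc)
qed

lemma norm_smult_vec: "norm (c *s v) = cmod c * norm (v :: complex ^ 'x)"
  by (simp add: norm_vec_def norm_mult L2_set_right_distrib)

lemma zero_mv: "0 *v v = (0 :: complex ^ 'x)"
  by (simp add: vec_eq_iff matrix_vector_mult_def)

lemma inner_mv:
  "(A *v v) \<bullet> w = v \<bullet> (conj_transpose A *v (w :: complex ^ 'x))" for v :: "complex ^ 'x"
proof -
  have *: "(a * b) \<bullet> c = b \<bullet> (cnj a * c)" for a b c :: complex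
    by (simp add: inner_complex_def algebra_simps)
  have "(A *v v) \<bullet> w = (\<Sum>i\<in>UNIV. \<Sum>j\<in>UNIV. v $ j \<bullet> (cnj (A $ i $ j) * w $ i))"
    by (simp add: inner_vec_def matrix_vector_mult_def inner_sum_left *)
  also have "\<dots> = (\<Sum>j\<in>UNIV. \<Sum>i\<in>UNIV. v $ j \<bullet> (cnj (A $ i $ j) * w $ i))"
    by (rule sum.swap)
  also have "\<dots> = v \<bullet> (conj_transpose A *v w)"
    by (simp add: inner_vec_def matrix_vector_mult_def inner_sum_right conj_transpose_def)
  finally show ?thesis .
qed

lemma onorm_mult_mv:
  "onorm ((*v) (A ** B)) \<le> onorm ((*v) A) * onorm ((*v) B)" for A B :: "complex ^ 'x ^ 'x"
proof -
  have "(*v) (A ** B) = (*v) A \<circ> (*v) B"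
    by (auto simp: matrix_vector_mul_assoc)
  then show ?thesis
    using onorm_compose[OF bl_mv bl_mv, of A B] by simp
qed

lemma onorm_cstar_le:
  "(onorm ((*v) A))\<^sup>2 \<le> onorm ((*v) (conj_transpose A ** (A :: complex ^ 'x ^ 'x)))"
    (is "_ \<le> ?k")
proof -
  have k0: "0 \<le> ?k" by (rule onorm_pos_le) simp
  have "norm (A *v v) \<le> sqrt ?k * norm v" for v
  proof -
    have "(norm (A *v v))\<^sup>2 = v \<bullet> ((conj_transpose A ** A) *v v)"
      by (simp add: dot_square_norm[symmetric] inner_mv matrix_vector_mul_assoc)
    also have "\<dots> \<le> norm v * norm ((conj_transpose A ** A) *v v)"
      by (rule norm_cauchy_schwarz)
    also have "\<dots> \<le> norm v * (?k * norm v)"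
      by (intro mult_left_mono onorm) simp_all
    also have "\<dots> = (sqrt ?k * norm v)\<^sup>2"
      using k0 by (simp add: power2_eq_square algebra_simps)
    finally show ?thesis
      by (rule power2_le_imp_le) (simp add: k0)
  qed
  then have "onorm ((*v) A) \<le> sqrt ?k"
    by (intro onorm_bound) (simp_all add: k0)
  then have "(onorm ((*v) A))\<^sup>2 \<le> (sqrt ?k)\<^sup>2"
    by (intro power_mono onorm_pos_le) simp_all
  with k0 show ?thesis by simp
qed

lemma conj_transpose_conj_transpose: "conj_transpose (conj_transpose A) = A"
  by (simp add: conj_transpose_def vec_eq_iff)

lemma onorm_conj_transpose:
  "onorm ((*v) (conj_transpose A)) = onorm ((*v) (A :: complex ^ 'x ^ 'x))"
proof -
  have le: "onorm ((*v) A) \<le> onorm ((*v) (conj_transpose A))" for A :: "complex ^ 'x ^ 'x"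
  proof -
    have "(onorm ((*v) A))\<^sup>2 \<le> onorm ((*v) (conj_transpose A)) * onorm ((*v) A)"
      using onorm_cstar_le[of A] onorm_mult_mv[of "conj_transpose A" A] by linarith
    then show ?thesis
      using onorm_pos_le[OF bl_mv, of A] onorm_pos_le[OF bl_mv, of "conj_transpose A"]
      by (cases "onorm ((*v) A) = 0") (auto simp: power2_eq_square)
  qed
  from le[of A] le[of "conj_transpose A"] show ?thesis
    by (simp add: conj_transpose_conj_transpose)
qed

lemma onorm_cstar:
  "onorm ((*v) (conj_transpose A ** A)) = (onorm ((*v) (A :: complex ^ 'x ^ 'x)))\<^sup>2"
  using onorm_cstar_le[of A] onorm_mult_mv[of "conj_transpose A" A]
  by (simp add: onorm_conj_transpose power2_eq_square)

text \<open>The operator norm and the Euclidean norm of the matrix are equivalent.\<close>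

lemma norm_le_onorm_mv:
  "norm (A $ i $ j) \<le> onorm ((*v) (A :: complex ^ 'x ^ 'x))"
proof -
  have "A $ i $ j = (A *v axis j 1) $ i"
    by (simp add: matrix_vector_mult_def axis_def if_distrib cong: if_cong)
  also have "norm \<dots> \<le> norm (A *v axis j 1)"
    by (rule Finite_Cartesian_Product.norm_nth_le)
  also have "\<dots> \<le> onorm ((*v) A) * norm (axis j 1 :: complex ^ 'x)"
    by (rule onorm) simp
  finally show ?thesis by simp
qed

lemma onorm_mv_le:
  "onorm ((*v) (A :: complex ^ 'x ^ 'x)) \<le> (\<Sum>i\<in>UNIV. \<Sum>j\<in>UNIV. norm (A $ i $ j))"
proof (rule onorm_bound)
  show "0 \<le> (\<Sum>i\<in>UNIV. \<Sum>j\<in>UNIV. norm (A $ i $ j))"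
    by (intro sum_nonneg) simp
  fix v :: "complex ^ 'x"
  have "norm (A *v v) \<le> (\<Sum>i\<in>UNIV. norm ((A *v v) $ i))"
    by (simp add: norm_vec_def L2_set_le_sum)
  also have "\<dots> \<le> (\<Sum>i\<in>UNIV. \<Sum>j\<in>UNIV. norm (A $ i $ j) * norm v)"
    unfolding matrix_vector_mult_def
    by (auto intro!: sum_mono order_trans[OF norm_sum] mult_left_mono
        simp: norm_mult Finite_Cartesian_Product.norm_nth_le)
  finally show "norm (A *v v) \<le> (\<Sum>i\<in>UNIV. \<Sum>j\<in>UNIV. norm (A $ i $ j)) * norm v"
    by (simp add: sum_distrib_right)
qed

instantiation ell2_op :: (finite) real_normed_algebra_1
begin

lift_definition zero_ell2_op :: "'a ell2_op" is 0 .
lift_definition one_ell2_op :: "'a ell2_op" is "mat 1" .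
lift_definition plus_ell2_op :: "'a ell2_op \<Rightarrow> 'a ell2_op \<Rightarrow> 'a ell2_op" is "(+)" .
lift_definition minus_ell2_op :: "'a ell2_op \<Rightarrow> 'a ell2_op \<Rightarrow> 'a ell2_op" is "(-)" .
lift_definition uminus_ell2_op :: "'a ell2_op \<Rightarrow> 'a ell2_op" is uminus .
lift_definition times_ell2_op :: "'a ell2_op \<Rightarrow> 'a ell2_op \<Rightarrow> 'a ell2_op" is "(**)" .
lift_definition scaleR_ell2_op :: "real \<Rightarrow> 'a ell2_op \<Rightarrow> 'a ell2_op" is scaleR .
lift_definition norm_ell2_op :: "'a ell2_op \<Rightarrow> real" is "\<lambda>A. onorm ((*v) A)" .

definition sgn_ell2_op :: "'a ell2_op \<Rightarrow> 'a ell2_op"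
  where "sgn_ell2_op x = inverse (norm x) *\<^sub>R x"

definition dist_ell2_op :: "'a ell2_op \<Rightarrow> 'a ell2_op \<Rightarrow> real"
  where "dist_ell2_op x y = norm (x - y)"

definition uniformity_ell2_op :: "('a ell2_op \<times> 'a ell2_op) filter"
  where "uniformity_ell2_op = (INF e\<in>{0 <..}. principal {(x, y). dist x y < e})"

definition open_ell2_op :: "'a ell2_op set \<Rightarrow> bool"
  where "open_ell2_op S = (\<forall>x\<in>S. \<forall>\<^sub>F (x', y) in uniformity. x' = x \<longrightarrow> y \<in> S)"

instance
proof
  fix x y z :: "'a ell2_op" and a b :: real and S :: "'a ell2_op set"
  show "x + y + z = x + (y + z)" by transfer (simp add: algebra_simps)
  show "x + y = y + x" by transfer (simp add: algebra_simps)
  show "0 + x = x" by transfer simp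
  show "- x + x = 0" by transfer simp
  show "x - y = x + - y" by transfer simp
  show "x * y * z = x * (y * z)" by transfer (simp add: matrix_mul_assoc)
  show "(x + y) * z = x * z + y * z"
    by transfer
       (rule mat_eqI, simp add: matrix_vector_mult_add_rdistrib matrix_vector_mul_assoc[symmetric])
  show "x * (y + z) = x * y + x * z" by transfer (simp add: matrix_add_ldistrib)
  show "1 * x = x" by transfer simp
  show "x * 1 = x" by transfer simp
  show "(0 :: 'a ell2_op) \<noteq> 1"
    by transfer (simp add: vec_eq_iff mat_def)
  show "a *\<^sub>R (x + y) = a *\<^sub>R x + a *\<^sub>R y" by transfer (simp add: algebra_simps)
  show "(a + b) *\<^sub>R x = a *\<^sub>R x + b *\<^sub>R x" by transfer (simp add: algebra_simps)
  show "a *\<^sub>R b *\<^sub>R x = (a * b) *\<^sub>R x" by transfer simp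
  show "1 *\<^sub>R x = x" by transfer simp
  show "a *\<^sub>R x * y = a *\<^sub>R (x * y)"
    by transfer (simp add: vec_eq_iff matrix_matrix_mult_def scaleR_sum_right)
  show "x * a *\<^sub>R y = a *\<^sub>R (x * y)"
    by transfer (simp add: vec_eq_iff matrix_matrix_mult_def scaleR_sum_right)
  show "sgn x = inverse (norm x) *\<^sub>R x" by (rule sgn_ell2_op_def)
  show "dist x y = norm (x - y)" by (rule dist_ell2_op_def)
  show "(uniformity :: ('a ell2_op \<times> 'a ell2_op) filter)
      = (INF e\<in>{0 <..}. principal {(x, y). dist x y < e})"
    by (rule uniformity_ell2_op_def)
  show "open S \<longleftrightarrow> (\<forall>x\<in>S. \<forall>\<^sub>F (x', y) in uniformity. x' = x \<longrightarrow> y \<in> S)"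
    by (rule open_ell2_op_def)
  show "norm x = 0 \<longleftrightarrow> x = 0"
    by transfer (auto simp: onorm_eq_0 matrix_eq zero_mv)
  show "norm (x + y) \<le> norm x + norm y"
    by transfer (simp only: mv_fun onorm_triangle bl_mv)
  show "norm (a *\<^sub>R x) = \<bar>a\<bar> * norm x"
    by transfer (simp only: mv_fun onorm_scaleR bl_mv)
  show "norm (x * y) \<le> norm x * norm y"
    by transfer (rule onorm_mult_mv)
  show "norm (1 :: 'a ell2_op) = 1"
    by transfer (simp only: mv_fun onorm_id)
qed

end

lemma norm_entry_le: "norm (mat_of_op x $ i $ j) \<le> norm x"
  by transfer (rule norm_le_onorm_mv)

lemma norm_le_entries: "norm x \<le> (\<Sum>i\<in>UNIV. \<Sum>j\<in>UNIV. norm (mat_of_op x $ i $ j))"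
  by transfer (rule onorm_mv_le)

instance ell2_op :: (finite) banach
proof
  fix X :: "nat \<Rightarrow> 'a ell2_op" assume X: "Cauchy X"
  have diff: "mat_of_op (x - y) $ i $ j = mat_of_op x $ i $ j - mat_of_op y $ i $ j"
    for x y :: "'a ell2_op" and i j
    by transfer simp
  have "Cauchy (\<lambda>n. mat_of_op (X n) $ i $ j)" for i j
    unfolding Cauchy_iff
  proof (intro allI impI)
    fix e :: real assume "0 < e"
    then obtain M where M: "\<forall>m\<ge>M. \<forall>n\<ge>M. norm (X m - X n) < e"
      using X unfolding Cauchy_iff by blast
    have "norm (mat_of_op (X m) $ i $ j - mat_of_op (X n) $ i $ j) < e" if "M \<le> m" "M \<le> n" for m n
      using M that norm_entry_le[of "X m - X n" i j] unfolding diff by force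
    then show "\<exists>M. \<forall>m\<ge>M. \<forall>n\<ge>M.
        norm (mat_of_op (X m) $ i $ j - mat_of_op (X n) $ i $ j) < e"
      by blast
  qed
  then have "\<exists>L. (\<lambda>n. mat_of_op (X n) $ i $ j) \<longlonglongrightarrow> L" for i j
    by (simp add: Cauchy_convergent_iff convergent_def)
  then obtain L where L: "\<And>i j. (\<lambda>n. mat_of_op (X n) $ i $ j) \<longlonglongrightarrow> L i j"
    by metis
  define Y where "Y = op_of_mat (\<chi> i j. L i j)"
  have Y: "mat_of_op Y $ i $ j = L i j" for i j
    by (simp add: Y_def op_of_mat_inverse)
  have "(\<lambda>n. \<Sum>i\<in>UNIV. \<Sum>j\<in>UNIV. norm (mat_of_op (X n - Y) $ i $ j)) \<longlonglongrightarrow>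
      (\<Sum>i\<in>(UNIV :: 'a set). \<Sum>j\<in>(UNIV :: 'a set). norm (L i j - L i j))"
    unfolding diff Y by (intro tendsto_intros L)
  then have lim: "(\<lambda>n. \<Sum>i\<in>UNIV. \<Sum>j\<in>UNIV. norm (mat_of_op (X n - Y) $ i $ j)) \<longlonglongrightarrow> 0"
    by simp
  have "(\<lambda>n. X n - Y) \<longlonglongrightarrow> 0"
    by (rule Lim_null_comparison[OF _ lim]) (intro always_eventually allI norm_le_entries)
  then have "X \<longlonglongrightarrow> Y"
    by (rule LIM_zero_cancel)
  then show "convergent X"
    by (auto simp: convergent_def)
qed

instantiation ell2_op :: (finite) cstar_algebra
begin

lift_definition scaleC_ell2_op :: "complex \<Rightarrow> 'a ell2_op \<Rightarrow> 'a ell2_op"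
  is "\<lambda>c A. \<chi> i j. c * A $ i $ j" .
lift_definition star_ell2_op :: "'a ell2_op \<Rightarrow> 'a ell2_op" is conj_transpose .

instance
proof
  fix x y :: "'a ell2_op" and c d :: complex and r :: real
  show "c *\<^sub>C (x + y) = c *\<^sub>C x + c *\<^sub>C y" by transfer (simp add: vec_eq_iff algebra_simps)
  show "(c + d) *\<^sub>C x = c *\<^sub>C x + d *\<^sub>C x" by transfer (simp add: vec_eq_iff algebra_simps)
  show "c *\<^sub>C d *\<^sub>C x = (c * d) *\<^sub>C x" by transfer (simp add: vec_eq_iff)
  show "1 *\<^sub>C x = x" by transfer (simp add: vec_eq_iff)
  show "r *\<^sub>R x = complex_of_real r *\<^sub>C x" by transfer (simp add: vec_eq_iff scaleR_conv_of_real[where 'a=complex])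
  show "(c *\<^sub>C x) * y = c *\<^sub>C (x * y)"
    by transfer (simp add: vec_eq_iff matrix_matrix_mult_def sum_distrib_left mult_ac)
  show "x * (c *\<^sub>C y) = c *\<^sub>C (x * y)"
    by transfer (simp add: vec_eq_iff matrix_matrix_mult_def sum_distrib_left mult_ac)
  show "norm (c *\<^sub>C x) = cmod c * norm x"
  proof transfer
    fix c :: complex and A :: "complex ^ 'a ^ 'a"
    show "onorm ((*v) (\<chi> i j. c * A $ i $ j)) = cmod c * onorm ((*v) A)"
      using onorm_scaleR[OF bl_mv, of "cmod c" A] by (simp add: onorm_def mv_fun norm_smult_vec)
  qed
  show "star (star x) = x" by transfer (rule conj_transpose_conj_transpose)
  show "star (x + y) = star x + star y" by transfer (simp add: conj_transpose_def vec_eq_iff)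
  show "star (c *\<^sub>C x) = cnj c *\<^sub>C star x" by transfer (simp add: conj_transpose_def vec_eq_iff)
  show "star (x * y) = star y * star x"
    by transfer (simp add: conj_transpose_def vec_eq_iff matrix_matrix_mult_def mult.commute)
  show "norm (star x * x) = (norm x)\<^sup>2" by transfer (rule onorm_cstar)
qed

end

lift_definition matrix_unit :: "'x::finite \<Rightarrow> 'x \<Rightarrow> 'x ell2_op"
  is "\<lambda>x y. \<chi> i j. if i = x \<and> j = y then 1 else 0" .

definition operator_system_of :: "('x::finite \<times> 'x) set \<Rightarrow> 'x ell2_op set"
  where "operator_system_of R = cspan {matrix_unit x y |x y. (x, y) \<in> R}"


section \<open>Graph diameter of a relation\<close>

text \<open>
  \<open>(x, y) \<in> R ^^ n\<close> says that there is a walk of length \<open>n\<close> from \<open>x\<close> to \<open>y\<close>; a shortest walk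
  is a path.  In particular the distance from \<open>x\<close> to itself is \<open>0\<close>.
\<close>

definition graph_distance :: "('x \<times> 'x) set \<Rightarrow> 'x \<Rightarrow> 'x \<Rightarrow> enat"
  where "graph_distance R x y = (INF n \<in> {n. (x, y) \<in> R ^^ n}. enat n)"

definition graph_diameter :: "('x::finite \<times> 'x) set \<Rightarrow> enat"
  where "graph_diameter R = Max {graph_distance R x y |x y. True}"

end

theory Submission
  imports Defs
begin

text \<open>
  \<^bold>\<open>The envelope.\<close>  Let \<open>\<kappa>\<close> embed the operator system \<open>E\<close> of a connected reflexive symmetric
  relation into a \<open>C\<^sup>*\<close>-algebra \<open>B\<close> that it generates.  A homomorphism \<open>\<rho>\<close> from \<open>B\<close> to the
  matrices with \<open>\<rho> \<circ> \<kappa> = id\<close> is obtained in two steps.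

  The functional \<open>[a\<^sub>x\<^sub>y] \<mapsto> \<Sum> (a\<^sub>x\<^sub>y)\<^sub>x\<^sub>y\<close> on matrices over \<open>E\<close> is the vector functional of
  \<open>\<Sum> e\<^sub>x \<otimes> e\<^sub>x\<close>, so it is positive.  As \<open>\<kappa>\<close> is a complete order isomorphism, it is also positive
  on matrices over \<open>\<kappa> E\<close>, and the extension theorem of M. Riesz (by Zorn's lemma) extends it to
  all matrices over \<open>B\<close>.  The theorem needs an order unit; it is provided by the fact that
  \<open>1 - h\<close> is a square for every small self-adjoint \<open>h\<close>.

  The extension defines a semi-inner product on \<open>B\<close>-valued vectors.  It is Stinespring's
  construction for a completely positive extension of \<open>\<kappa>\<^sup>-\<^sup>1\<close>.  With vectors \<open>\<xi>\<^sub>x\<close> for the copies of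
  the basis, the crucial point is that \<open>\<kappa>(e\<^sub>x\<^sub>y) \<xi>\<^sub>z = \<delta>\<^sub>y\<^sub>z \<xi>\<^sub>x\<close> modulo null vectors, for every edge
  \<open>(x, y)\<close> (lemma \<open>rep_matrix_unit\<close>): positivity of the \<open>2 \<times> 2\<close> block with entries
  \<open>e\<^sub>x\<^sub>x, e\<^sub>x\<^sub>y, e\<^sub>y\<^sub>x, e\<^sub>y\<^sub>y\<close> yields the case of equality in the Cauchy--Schwarz inequality.
  Hence the span of the \<open>\<xi>\<^sub>x\<close> is invariant under \<open>\<kappa> E\<close>, and so under the algebra \<open>B\<close>
  that it generates, and \<open>\<rho>\<close> is the action of \<open>B\<close> on this span.  It is unique because unital
  homomorphisms into matrices are continuous.  Connectedness says that \<open>E\<close> generates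
  the matrices.

  \<^bold>\<open>The propagation number.\<close>  For \<open>n \<ge> 1\<close>, products of at most \<open>n\<close> elements of \<open>E\<close> span the matrices supported
  on \<open>R ^^ n\<close>.  These form an algebra exactly if \<open>R ^^ n\<close> is transitive, that is, by connectedness,
  if \<open>R ^^ n\<close> is everything, which means \<open>diam R \<le> n\<close>.  Any other envelope is a copy of this one,
  because a unital homomorphism out of the matrices is bounded below.
\<close>

section \<open>Squares in a \<open>C\<^sup>*\<close>-algebra\<close>

interpretation complex_scaling:
  vector_space "scaleC :: complex \<Rightarrow> 'a::cstar_algebra \<Rightarrow> 'a"
  by (rule vector_space_scaleC)

lemma star_0 [simp]: "star (0 :: 'a::cstar_algebra) = 0"
  using star_add[of "0::'a" 0] by simp

lemma star_minus: "star (- x) = - star (x :: 'a::cstar_algebra)"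
  using star_add[of x "- x"] by (simp add: eq_neg_iff_add_eq_0 add.commute)

lemma star_diff: "star (x - y) = star x - star (y :: 'a::cstar_algebra)"
  using star_add[of x "- y"] by (simp add: star_minus)

lemma star_1 [simp]: "star (1 :: 'a::cstar_algebra) = 1"
  by (metis mult.left_neutral mult.right_neutral star_mult star_star)

lemma star_scaleR: "star (r *\<^sub>R x) = r *\<^sub>R star (x :: 'a::cstar_algebra)"
  by (simp add: scaleR_scaleC star_scaleC)

lemma norm_star: "norm (star x) = norm (x :: 'a::cstar_algebra)"
proof -
  have le: "norm y \<le> norm (star y)" for y :: 'a
  proof (cases "y = 0")
    case False
    have "norm y * norm y \<le> norm (star y) * norm y"
      using cstar_identity[of y] norm_mult_ineq[of "star y" y] by (simp add: power2_eq_square)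
    with False show ?thesis by simp
  qed simp
  show ?thesis using le[of x] le[of "star x"] by (simp add: star_star)
qed

lemma bounded_linear_star: "bounded_linear (star :: 'a::cstar_algebra \<Rightarrow> 'a)"
  by (rule bounded_linear_intro[where K=1]) (simp_all add: star_add star_scaleR norm_star)

text \<open>
  Writing the root as \<open>1 - y\<close> turns \<open>(1 - y)\<^sup>2 = 1 - h\<close> into the fixed-point equation
  \<open>y = (h + y\<^sup>2) / 2\<close>, whose right-hand side is a contraction of the complete set of self-adjoint
  elements of norm at most \<open>1/2\<close>.
\<close>

lemma selfadjoint_sqrt_one_minus:
  fixes h :: "'a::cstar_algebra"
  assumes sa: "star h = h" and small: "norm h \<le> 1/2"
  obtains s where "star s = s" and "s * s = 1 - h"
proof -
  define S where "S = {y :: 'a. norm y \<le> 1/2 \<and> star y = y}"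
  define T where "T y = (1/2) *\<^sub>R (h + y * y)" for y
  have cs: "continuous_on UNIV (star :: 'a \<Rightarrow> 'a)"
    using bounded_linear_star linear_continuous_on by blast
  have "closed S"
    unfolding S_def by (intro closed_Collect_conj closed_Collect_le closed_Collect_eq
        continuous_intros cs)
  then have "complete S" by (simp add: complete_eq_closed)
  moreover have "S \<noteq> {}" unfolding S_def by (auto intro!: exI[of _ 0])
  moreover have "T ` S \<subseteq> S"
  proof safe
    fix y assume "y \<in> S"
    then have y: "norm y \<le> 1/2" "star y = y" by (auto simp: S_def)
    have "norm (y * y) \<le> 1/2 * (1/2)"
      using norm_mult_ineq[of y y] mult_mono[OF y(1) y(1)] by simp
    then have "norm (h + y * y) \<le> 1"
      using norm_triangle_ineq[of h "y * y"] small by simp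
    then show "T y \<in> S"
      by (simp add: S_def T_def star_scaleR star_add star_mult sa y(2))
  qed
  moreover have "dist (T y) (T z) \<le> 1/2 * dist y z" if "y \<in> S" "z \<in> S" for y z
  proof -
    have ny: "norm y \<le> 1/2" and nz: "norm z \<le> 1/2" using that by (auto simp: S_def)
    have "T y - T z = (1/2) *\<^sub>R (y * (y - z) + (y - z) * z)"
      by (simp add: T_def algebra_simps)
    then have "norm (T y - T z) \<le> 1/2 * (norm (y * (y - z)) + norm ((y - z) * z))"
      by (simp add: norm_triangle_ineq)
    also have "\<dots> \<le> 1/2 * (1/2 * norm (y - z) + norm (y - z) * (1/2))"
      by (intro mult_left_mono add_mono order_trans[OF norm_mult_ineq] mult_mono ny nz) auto
    finally show ?thesis by (simp add: dist_norm)
  qed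
  ultimately obtain y where y: "y \<in> S" "T y = y"
    using Banach_fix[of S "1/2" T] by auto
  have "h + y * y = 2 *\<^sub>R T y" by (simp add: T_def)
  then have "(1 - y) * (1 - y) = 1 - h"
    by (simp add: y(2) algebra_simps scaleR_2)
  then show thesis
    using that[of "1 - y"] y(1) by (auto simp: S_def star_diff)
qed

text \<open>
  The optimal constant would be \<open>(norm a)\<^sup>2\<close>; the factor \<open>2\<close> brings the rescaled \<open>a\<^sup>* a\<close> into
  the range of the square root above.  This is the only source of order bounds and of continuity
  in what follows.
\<close>

lemma square_dominated:
  fixes a :: "'a::cstar_algebra"
  obtains s where "star s * s = (2 * (norm a)\<^sup>2) *\<^sub>R 1 - star a * a"
proof (cases "a = 0")
  case True
  with that[of 0] show thesis by simp
next
  case False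
  define t where "t = 2 * (norm a)\<^sup>2"
  have t: "t > 0" using False by (simp add: t_def)
  have "star ((1/t) *\<^sub>R (star a * a)) = (1/t) *\<^sub>R (star a * a)"
    by (simp add: star_scaleR star_mult star_star)
  moreover have "norm ((1/t) *\<^sub>R (star a * a)) \<le> 1/2"
    using t False by (simp add: cstar_identity t_def)
  ultimately obtain s where s: "star s = s" "s * s = 1 - (1/t) *\<^sub>R (star a * a)"
    by (rule selfadjoint_sqrt_one_minus)
  have "star (sqrt t *\<^sub>R s) * (sqrt t *\<^sub>R s) = t *\<^sub>R (s * s)"
    using t by (simp add: star_scaleR s(1))
  also have "\<dots> = t *\<^sub>R 1 - star a * a"
    using t by (simp add: s(2) algebra_simps)
  finally show thesis using that t_def by blast
qed

section \<open>Extension of positive functionals\<close>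

text \<open>
  A maximal cone \<open>M\<close> that avoids \<open>-u\<close> is total: if \<open>v\<close> is not in \<open>M\<close>, then \<open>M\<close> and \<open>v\<close> together
  generate \<open>-u = m + t v\<close>, which expresses \<open>-v\<close> as a positive multiple of \<open>m + u\<close>.
\<close>

lemma maximal_convex_cone:
  fixes C :: "'v::real_vector set"
  assumes C: "convex_cone C" "- u \<notin> C" "u \<in> C"
  obtains M where "convex_cone M" "C \<subseteq> M" "- u \<notin> M" "\<And>v. v \<in> M \<or> - v \<in> M"
proof -
  define A where "A = {M. convex_cone M \<and> C \<subseteq> M \<and> - u \<notin> M}"
  have "\<exists>M\<in>A. \<forall>X\<in>A. M \<subseteq> X \<longrightarrow> X = M"
  proof (rule subset_Zorn_nonempty)
    show "A \<noteq> {}" using C by (auto simp: A_def)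
    fix K assume K: "K \<noteq> {}" "subset.chain A K"
    have comp: "X \<subseteq> Y \<or> Y \<subseteq> X" if "X \<in> K" "Y \<in> K" for X Y
      using K(2) that by (auto simp: subset_chain_def)
    have KA: "K \<subseteq> A" using K(2) by (auto simp: subset_chain_def)
    have "convex_cone (\<Union>K)"
      unfolding convex_cone_iff
    proof (intro conjI ballI allI impI)
      show "0 \<in> \<Union>K" using K(1) KA by (auto simp: A_def convex_cone_iff)
      show "x + y \<in> \<Union>K" if xy: "x \<in> \<Union>K" "y \<in> \<Union>K" for x y
      proof -
        obtain X Y where XY: "X \<in> K" "Y \<in> K" "x \<in> X" "y \<in> Y" using xy by blast
        then obtain Z where "Z \<in> K" "x \<in> Z" "y \<in> Z" using comp[of X Y] by blast
        moreover from this have "convex_cone Z" using KA by (auto simp: A_def)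
        ultimately show ?thesis using convex_cone_add by blast
      qed
      show "c *\<^sub>R x \<in> \<Union>K" if cx: "x \<in> \<Union>K" "0 \<le> c" for x c
      proof -
        obtain X where "X \<in> K" "x \<in> X" using cx(1) by blast
        moreover from this have "convex_cone X" using KA by (auto simp: A_def)
        ultimately show ?thesis using convex_cone_scaleR cx(2) by blast
      qed
    qed
    then show "\<Union>K \<in> A" using K(1) KA by (auto simp: A_def)
  qed
  then obtain M where M: "convex_cone M" "C \<subseteq> M" "- u \<notin> M"
    and mx: "\<And>X. convex_cone X \<Longrightarrow> - u \<notin> X \<Longrightarrow> M \<subseteq> X \<Longrightarrow> X = M"
    by (auto simp: A_def)
  have "v \<in> M \<or> - v \<in> M" for v
  proof (rule ccontr)
    assume neg: "\<not> ?thesis"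
    define X where "X = (\<Union>m\<in>M. \<Union>y\<in>{t *\<^sub>R v |t. 0 \<le> t}. {m + y})"
    have "convex_cone {t *\<^sub>R v |t. 0 \<le> t}"
      unfolding convex_cone_iff
      by (auto intro: exI[of _ 0] simp: scaleR_left_distrib[symmetric])
    then have cX: "convex_cone X"
      unfolding X_def by (rule convex_cone_sums[OF M(1)])
    have MX: "M \<subseteq> X"
      unfolding X_def by (force intro: exI[of _ 0])
    have vX: "v \<in> X"
      unfolding X_def using convex_cone_contains_0[OF M(1)] by (force intro: exI[of _ 1])
    have "- u \<in> X" using mx[OF cX _ MX] vX neg by auto
    then obtain m t where mt: "m \<in> M" "0 \<le> t" "- u = m + t *\<^sub>R v"
      unfolding X_def by auto
    have "t \<noteq> 0" using mt M(3) by auto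
    have "u = - (m + t *\<^sub>R v)" using mt(3) by (metis minus_minus)
    then have "m + u = t *\<^sub>R (- v)" by simp
    then have "- v = (1/t) *\<^sub>R (m + u)" using \<open>t \<noteq> 0\<close> by simp
    moreover have "(1/t) *\<^sub>R (m + u) \<in> M"
      using M C(3) mt by (intro convex_cone_scaleR convex_cone_add) auto
    ultimately show False using neg by simp
  qed
  then show thesis using that M by blast
qed

text \<open>
  A total cone with order unit \<open>u\<close> is a total preorder, and comparing \<open>v\<close> with the multiples of
  \<open>u\<close> is a Dedekind cut that defines \<open>f v\<close>.  Adding lower bounds makes \<open>f\<close> superadditive,
  totality makes it odd, and an odd superadditive function is additive.
\<close>

lemma total_cone_functional:
  fixes M :: "'v::real_vector set"
  assumes M: "convex_cone M" and total: "\<And>v. v \<in> M \<or> - v \<in> M" and u: "- u \<notin> M"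
    and unit: "\<And>v. \<exists>t. v + t *\<^sub>R u \<in> M"
  obtains f :: "'v \<Rightarrow> real" where "linear f" "f u = 1" "\<And>v. v \<in> M \<Longrightarrow> 0 \<le> f v"
proof -
  have add: "x + y \<in> M" if "x \<in> M" "y \<in> M" for x y using convex_cone_add[OF M that] .
  have scale: "c *\<^sub>R x \<in> M" if "x \<in> M" "0 \<le> c" for x c
    using convex_cone_scaleR[OF M that(2) that(1)] .
  have uM: "u \<in> M" using total u by blast
  define L where "L v = {t. v - t *\<^sub>R u \<in> M}" for v
  define f where "f v = Sup (L v)" for v
  have tu: "t *\<^sub>R u \<in> M \<longleftrightarrow> 0 \<le> t" for t
  proof
    assume t: "t *\<^sub>R u \<in> M"
    show "0 \<le> t"
    proof (rule ccontr)
      assume "\<not> 0 \<le> t"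
      then have "(- 1/t) *\<^sub>R (t *\<^sub>R u) \<in> M" by (intro scale t) (simp add: divide_nonneg_neg)
      with \<open>\<not> 0 \<le> t\<close> u show False by simp
    qed
  qed (rule scale[OF uM])
  have ne: "L v \<noteq> {}" for v
  proof -
    obtain t where "v + t *\<^sub>R u \<in> M" using unit by blast
    then have "- t \<in> L v" by (simp add: L_def)
    then show ?thesis by blast
  qed
  have bdd: "bdd_above (L v)" for v
  proof -
    obtain s where s: "- v + s *\<^sub>R u \<in> M" using unit by blast
    have "t \<le> s" if "t \<in> L v" for t
    proof -
      have "v - t *\<^sub>R u \<in> M" using that by (simp add: L_def)
      from add[OF this s] have "(v - t *\<^sub>R u) + (- v + s *\<^sub>R u) \<in> M" .
      then have "(s - t) *\<^sub>R u \<in> M" by (simp add: algebra_simps)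
      then show ?thesis by (simp add: tu)
    qed
    then show ?thesis by (rule bdd_aboveI)
  qed
  have upper: "t \<le> f v" if "v - t *\<^sub>R u \<in> M" for t v
    unfolding f_def by (rule cSup_upper[OF _ bdd]) (simp add: L_def that)
  have below: "v - t *\<^sub>R u \<in> M" if t: "t < f v" for t v
  proof -
    obtain s where s: "s \<in> L v" "t < s"
      using t less_cSup_iff[OF ne bdd] by (auto simp: f_def)
    have "(v - s *\<^sub>R u) + (s - t) *\<^sub>R u \<in> M"
      using s by (intro add scale uM) (auto simp: L_def)
    then show ?thesis by (simp add: algebra_simps)
  qed
  have above: "t *\<^sub>R u - v \<in> M" if "f v < t" for t v
  proof -
    have "v - t *\<^sub>R u \<notin> M" using upper[of v t] that by auto
    then show ?thesis using total[of "v - t *\<^sub>R u"] by simp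
  qed
  have f0: "f 0 = 0"
  proof -
    have "L 0 = {..0}" using tu[of "- t" for t] by (auto simp: L_def)
    then show ?thesis by (simp add: f_def)
  qed
  have super: "f v + f w \<le> f (v + w)" for v w
  proof (rule field_le_epsilon)
    fix e :: real assume e: "0 < e"
    have "(v - (f v - e/2) *\<^sub>R u) + (w - (f w - e/2) *\<^sub>R u) \<in> M"
      using e by (intro add below) auto
    moreover have "(v - (f v - e/2) *\<^sub>R u) + (w - (f w - e/2) *\<^sub>R u)
        = (v + w) - ((f v - e/2) + (f w - e/2)) *\<^sub>R u"
      unfolding scaleR_left_distrib by simp
    ultimately have "(v + w) - ((f v - e/2) + (f w - e/2)) *\<^sub>R u \<in> M" by simp
    then have "(f v - e/2) + (f w - e/2) \<le> f (v + w)" by (rule upper)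
    then show "f v + f w \<le> f (v + w) + e" by simp
  qed
  have minus: "f (- v) = - f v" for v
  proof (rule antisym)
    show "f (- v) \<le> - f v" using super[of v "- v"] by (simp add: f0)
    show "- f v \<le> f (- v)"
    proof (rule field_le_epsilon)
      fix e :: real assume e: "0 < e"
      have "(f v + e) *\<^sub>R u - v \<in> M" using e by (intro above) auto
      then have "- v - (- (f v + e)) *\<^sub>R u \<in> M" by (simp add: algebra_simps)
      then have "- (f v + e) \<le> f (- v)" by (rule upper)
      then show "- f v \<le> f (- v) + e" by simp
    qed
  qed
  have fadd: "f (v + w) = f v + f w" for v w
    using super[of v w] super[of "- v" "- w"] minus[of "v + w"] minus[of v] minus[of w]
    by (simp add: add.commute)
  have le: "r * f v \<le> f (r *\<^sub>R v)" if r: "0 < r" for r v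
  proof (rule field_le_epsilon)
    fix e :: real assume e: "0 < e"
    have "r *\<^sub>R (v - (f v - e/r) *\<^sub>R u) \<in> M" using e r by (intro scale below) auto
    then have "r *\<^sub>R v - (r * f v - e) *\<^sub>R u \<in> M" using r by (simp add: algebra_simps)
    then show "r * f v \<le> f (r *\<^sub>R v) + e" using upper[of "r *\<^sub>R v" "r * f v - e"] by simp
  qed
  have pos_scale: "f (r *\<^sub>R v) = r * f v" if r: "0 < r" for r v
  proof (rule antisym[OF _ le[OF r]])
    have "(1/r) * f (r *\<^sub>R v) \<le> f v" using le[of "1/r" "r *\<^sub>R v"] r by simp
    then show "f (r *\<^sub>R v) \<le> r * f v" using r by (simp add: field_simps)
  qed
  have fscale: "f (r *\<^sub>R v) = r * f v" for r v
  proof (cases r "0 :: real" rule: linorder_cases)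
    case less
    then have "f ((- r) *\<^sub>R v) = - r * f v" by (intro pos_scale) simp
    then show ?thesis by (simp add: minus)
  qed (simp_all add: f0 pos_scale)
  show thesis
  proof
    show "linear f" by (intro linearI) (simp_all add: fadd fscale)
    have "L u = {..1}"
      using tu[of "1 - t" for t] by (auto simp: L_def algebra_simps)
    then show "f u = 1" by (simp add: f_def)
    show "0 \<le> f v" if "v \<in> M" for v using upper[of v 0] that by simp
  qed
qed

text \<open>
  The extension theorem of M. Riesz.  Enlarging \<open>C\<close> by the half-space \<open>f0 \<ge> 0\<close> of \<open>S\<close>
  keeps \<open>-u\<close> outside, so the functional of a total cone above it exists.  It vanishes wherever
  \<open>f0\<close> does, because the kernel of \<open>f0\<close> lies in the cone with both signs.
\<close>

theorem positive_functional_extension: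
  fixes C S :: "'v::real_vector set" and f0 :: "'v \<Rightarrow> real"
  assumes C: "convex_cone C" and S: "subspace S" and uS: "u \<in> S"
    and unit: "\<And>v. \<exists>t. v + t *\<^sub>R u \<in> C"
    and add0: "\<And>x y. x \<in> S \<Longrightarrow> y \<in> S \<Longrightarrow> f0 (x + y) = f0 x + f0 y"
    and scale0: "\<And>r x. x \<in> S \<Longrightarrow> f0 (r *\<^sub>R x) = r * f0 x"
    and fu: "0 < f0 u"
    and pos: "\<And>x. x \<in> S \<Longrightarrow> x \<in> C \<Longrightarrow> 0 \<le> f0 x"
  obtains f :: "'v \<Rightarrow> real" where "linear f" "\<And>x. x \<in> C \<Longrightarrow> 0 \<le> f x" "\<And>x. x \<in> S \<Longrightarrow> f x = f0 x"
proof -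
  \<comment> \<open>The half-space of \<open>S\<close> on which the given functional is nonnegative.\<close>
  define P where "P = {x \<in> S. 0 \<le> f0 x}"
  define C0 where "C0 = (\<Union>c\<in>C. \<Union>p\<in>P. {c + p})"
  have f00: "f0 0 = 0" using scale0[OF uS, of 0] by simp
  have "convex_cone P"
    unfolding P_def convex_cone_iff using S
    by (auto simp: f00 add0 scale0 subspace_0 subspace_add subspace_scale)
  then have C0: "convex_cone C0" unfolding C0_def by (rule convex_cone_sums[OF C])
  have PC0: "P \<subseteq> C0" unfolding C0_def using convex_cone_contains_0[OF C] by force
  have "0 \<in> P" using S by (simp add: P_def f00 subspace_0)
  then have CC0: "C \<subseteq> C0" unfolding C0_def by force
  have uP: "u \<in> P" using uS fu by (simp add: P_def)
  have "- u \<notin> C0"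
  proof
    assume "- u \<in> C0"
    then obtain c p where cp: "c \<in> C" "p \<in> S" "0 \<le> f0 p" "- u = c + p"
      by (auto simp: C0_def P_def)
    then have c: "c = (- 1) *\<^sub>R u + (- 1) *\<^sub>R p" by (simp add: algebra_simps)
    have "c \<in> S" unfolding c using S uS cp(2) by (intro subspace_add subspace_scale) auto
    then have "0 \<le> f0 c" using pos cp(1) by blast
    moreover have "f0 c = - f0 u - f0 p"
      unfolding c using S uS cp(2) by (subst add0) (auto simp: scale0 subspace_scale subspace_neg scale0[of _ "-1", simplified])
    ultimately show False using fu cp(3) by simp
  qed
  then obtain M where M: "convex_cone M" "C0 \<subseteq> M" "- u \<notin> M" "\<And>v. v \<in> M \<or> - v \<in> M"
    using maximal_convex_cone[OF C0] PC0 uP by blast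
  have "\<exists>t. v + t *\<^sub>R u \<in> M" for v using unit[of v] CC0 M(2) by blast
  then obtain f :: "'v \<Rightarrow> real" where f: "linear f" "f u = 1" "\<And>v. v \<in> M \<Longrightarrow> 0 \<le> f v"
    using total_cone_functional[OF M(1) M(4) M(3)] by blast
  have fS: "f x = f0 x / f0 u" if x: "x \<in> S" for x
  proof -
    define y where "y = x + (- (f0 x / f0 u)) *\<^sub>R u"
    have yS: "y \<in> S" unfolding y_def using S x uS by (intro subspace_add subspace_scale)
    have "f0 y = f0 x + (- (f0 x / f0 u)) * f0 u"
      unfolding y_def using S x uS by (simp only: add0 scale0 subspace_scale)
    then have y0: "f0 y = 0" using fu by simp
    then have "f0 (- y) = 0" using scale0[OF yS, of "-1"] by simp
    then have "y \<in> P" "- y \<in> P" using yS y0 S by (auto simp: P_def subspace_neg)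
    then have "0 \<le> f y" "0 \<le> f (- y)" using f(3) PC0 M(2) by auto
    then have "f y = 0" using linear_neg[OF f(1)] by simp
    moreover have "f y = f x + (- (f0 x / f0 u)) * f u"
      unfolding y_def by (simp only: linear_add[OF f(1)] linear_cmul[OF f(1)] real_scaleR_def)
    ultimately show ?thesis by (simp add: f(2))
  qed
  show thesis
  proof
    show "linear (\<lambda>x. f0 u * f x)" using linear_compose_scale_right[OF f(1)] by simp
    show "0 \<le> f0 u * f x" if "x \<in> C" for x using f(3) that CC0 M(2) fu by auto
    show "f0 u * f x = f0 x" if "x \<in> S" for x using fS[OF that] fu by simp
  qed
qed

section \<open>Matrices supported on a relation\<close>

abbreviation entry :: "'x::finite ell2_op \<Rightarrow> 'x \<Rightarrow> 'x \<Rightarrow> complex"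
  where "entry A x y \<equiv> mat_of_op A $ x $ y"

lemma op_eqI: "(\<And>x y. entry A x y = entry B x y) \<Longrightarrow> A = B"
  by (metis mat_of_op_inject vec_eq_iff)

lemma entry_op_of_mat [simp]: "entry (op_of_mat A) x y = A $ x $ y"
  by (simp add: op_of_mat_inverse)

lemma entry_0 [simp]: "entry 0 x y = 0" by transfer simp
lemma entry_add [simp]: "entry (A + B) x y = entry A x y + entry B x y" by transfer simp
lemma entry_scaleC [simp]: "entry (c *\<^sub>C A) x y = c * entry A x y" by transfer simp
lemma entry_scaleR [simp]: "entry (r *\<^sub>R A) x y = r *\<^sub>R entry A x y" by transfer simp
lemma entry_star [simp]: "entry (star A) x y = cnj (entry A y x)"
  by transfer (simp add: conj_transpose_def)
lemma entry_mult: "entry (A * B) x y = (\<Sum>z\<in>UNIV. entry A x z * entry B z y)"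
  by transfer (simp add: matrix_matrix_mult_def)
lemma entry_1: "entry 1 x y = (if x = y then 1 else 0)" by transfer (simp add: mat_def)
lemma entry_matrix_unit: "entry (matrix_unit a b) x y = (if x = a \<and> y = b then 1 else 0)"
  by transfer simp
lemma entry_sum: "entry (sum F I) x y = (\<Sum>i\<in>I. entry (F i) x y)"
  by (induction I rule: infinite_finite_induct) simp_all

lemma matrix_unit_mult:
  "matrix_unit a b * matrix_unit c d = (if b = c then matrix_unit a d else 0)"
  by (rule op_eqI) (auto simp: entry_mult entry_matrix_unit if_distrib[where f="\<lambda>t. t * _"]
      sum.delta' cong: if_cong)

lemma star_matrix_unit: "star (matrix_unit a b) = matrix_unit b a"
  by (rule op_eqI) (auto simp: entry_matrix_unit)

lemma sum_matrix_unit_diag: "(\<Sum>x\<in>UNIV. matrix_unit x x) = 1"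
  by (rule op_eqI) (auto simp: entry_sum entry_matrix_unit entry_1 if_distrib sum.delta' cong: if_cong
      intro!: sum.neutral)

lemma op_expansion: "A = (\<Sum>x\<in>UNIV. \<Sum>y\<in>UNIV. entry A x y *\<^sub>C matrix_unit x y)"
proof (rule op_eqI)
  fix x y
  have "(\<Sum>a\<in>UNIV. \<Sum>b\<in>UNIV. entry A a b * (if x = a \<and> y = b then 1 else 0))
      = (\<Sum>a\<in>UNIV. if x = a then entry A x y else 0)"
    by (intro sum.cong refl) (auto simp: if_distrib[where f="\<lambda>t. _ * t"] cong: if_cong)
  then show "entry A x y = entry (\<Sum>x\<in>UNIV. \<Sum>y\<in>UNIV. entry A x y *\<^sub>C matrix_unit x y) x y"
    by (simp add: entry_sum entry_matrix_unit)
qed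

lemma mem_operator_system_of:
  "A \<in> operator_system_of R \<longleftrightarrow> (\<forall>x y. (x, y) \<notin> R \<longrightarrow> entry A x y = 0)"
proof
  assume "A \<in> operator_system_of R"
  then show "\<forall>x y. (x, y) \<notin> R \<longrightarrow> entry A x y = 0"
    unfolding operator_system_of_def
    by (induction rule: complex_scaling.span_induct_alt) (auto simp: entry_matrix_unit split: if_splits)
next
  assume A: "\<forall>x y. (x, y) \<notin> R \<longrightarrow> entry A x y = 0"
  have "(\<Sum>x\<in>UNIV. \<Sum>y\<in>UNIV. entry A x y *\<^sub>C matrix_unit x y) \<in> operator_system_of R"
    unfolding operator_system_of_def
  proof (rule complex_scaling.span_sum, rule complex_scaling.span_sum)
    fix x y
    show "entry A x y *\<^sub>C matrix_unit x y \<in> cspan {matrix_unit x y |x y. (x, y) \<in> R}"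
    proof (cases "(x, y) \<in> R")
      case True
      then show ?thesis by (intro complex_scaling.span_scale complex_scaling.span_base) auto
    next
      case False
      then show ?thesis using A by (simp add: complex_scaling.span_zero)
    qed
  qed
  then show "A \<in> operator_system_of R" using op_expansion[of A] by simp
qed

lemma operator_system_operator_system_of:
  assumes "sym R" "refl R"
  shows "operator_system (operator_system_of R)"
proof -
  have "(y, x) \<notin> R" if "(x, y) \<notin> R" for x y using assms(1) that by (auto dest: symD)
  with assms(2) show ?thesis
    unfolding operator_system_def complex_scaling.subspace_def
    by (auto simp: mem_operator_system_of entry_1 refl_on_def)
qed

text \<open>
  The block is \<open>b\<^sup>* b\<close> for the row \<open>b = (e\<^sub>x\<^sub>x, e\<^sub>x\<^sub>y)\<close>, padded by a zero row.
\<close>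

lemma positive_matrix_unit_block:
  "positive_matrix 2 (\<lambda>i j. matrix_unit (if i = 0 then x else y) (if j = 0 then x else y))"
  unfolding positive_matrix_def
proof (intro exI[of _ "\<lambda>k j. if k = (0::nat) then matrix_unit x (if j = (0::nat) then x else y) else 0"]
    allI impI)
  fix i j :: nat
  show "matrix_unit (if i = 0 then x else y) (if j = 0 then x else y) =
     (\<Sum>k<2. star (if k = (0::nat) then matrix_unit x (if i = 0 then x else y) else 0)
     * (if k = 0 then matrix_unit x (if j = 0 then x else y) else 0))"
    by (simp add: numeral_2_eq_2 star_matrix_unit matrix_unit_mult)
qed

section \<open>Complete order embeddings\<close>

locale complete_order_embedding =
  fixes E :: "'x::finite ell2_op set" and \<kappa> :: "'x ell2_op \<Rightarrow> 'b::cstar_algebra"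
  assumes E: "operator_system E" and \<kappa>: "unital_complete_order_iso_on E \<kappa>"
begin

lemma E_closed:
  shows "1 \<in> E" "0 \<in> E" "x \<in> E \<Longrightarrow> y \<in> E \<Longrightarrow> x + y \<in> E" "x \<in> E \<Longrightarrow> c *\<^sub>C x \<in> E"
    "x \<in> E \<Longrightarrow> star x \<in> E" "x \<in> E \<Longrightarrow> r *\<^sub>R x \<in> E" "x \<in> E \<Longrightarrow> y \<in> E \<Longrightarrow> x - y \<in> E"
  using E unfolding operator_system_def
  by (auto simp: scaleR_scaleC intro: complex_scaling.subspace_0 complex_scaling.subspace_add
      complex_scaling.subspace_scale complex_scaling.subspace_diff)

lemma \<kappa>_add: "x \<in> E \<Longrightarrow> y \<in> E \<Longrightarrow> \<kappa> (x + y) = \<kappa> x + \<kappa> y"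
  and \<kappa>_scaleC: "x \<in> E \<Longrightarrow> \<kappa> (c *\<^sub>C x) = c *\<^sub>C \<kappa> x"
  and \<kappa>_1: "\<kappa> 1 = 1"
  and \<kappa>_inj: "inj_on \<kappa> E"
  and \<kappa>_positive: "(\<And>i j. i < n \<Longrightarrow> j < n \<Longrightarrow> a i j \<in> E) \<Longrightarrow>
      positive_matrix n (\<lambda>i j. \<kappa> (a i j)) \<longleftrightarrow> positive_matrix n a"
  using \<kappa> unfolding unital_complete_order_iso_on_def by blast+

lemma \<kappa>_0: "\<kappa> 0 = 0"
  using \<kappa>_scaleC[of 0 0] E_closed(2) by simp

lemma \<kappa>_scaleR: "x \<in> E \<Longrightarrow> \<kappa> (r *\<^sub>R x) = r *\<^sub>R \<kappa> x"
  by (simp add: scaleR_scaleC \<kappa>_scaleC)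

lemma \<kappa>_diff: "x \<in> E \<Longrightarrow> y \<in> E \<Longrightarrow> \<kappa> (x - y) = \<kappa> x - \<kappa> y"
  using \<kappa>_add[of "x - y" y] E_closed(7)[of x y] by (simp add: algebra_simps)

lemma \<kappa>_sum: "(\<And>i. i \<in> I \<Longrightarrow> f i \<in> E) \<Longrightarrow> sum f I \<in> E \<and> \<kappa> (sum f I) = (\<Sum>i\<in>I. \<kappa> (f i))"
  by (induction I rule: infinite_finite_induct) (auto simp: \<kappa>_0 \<kappa>_add E_closed)

text \<open>
  An order isomorphism preserves self-adjointness because \<open>1 - r h\<close> is a square for a
  self-adjoint \<open>h\<close> and small \<open>r > 0\<close>, so that its image is positive.  The general case
  follows from \<open>x + x\<^sup>*\<close> and \<open>\<i> (x - x\<^sup>*)\<close>.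
\<close>

lemma \<kappa>_star:
  assumes "x \<in> E"
  shows "\<kappa> (star x) = star (\<kappa> x)"
proof -
  have sa: "star (\<kappa> h) = \<kappa> h" if hE: "h \<in> E" and sh: "star h = h" for h
  proof -
    define r where "r = 1 / (2 * norm h + 1)"
    have pos: "0 < 2 * norm h + 1" using norm_ge_zero[of h] by linarith
    then have r: "0 < r" by (simp add: r_def)
    have "norm (r *\<^sub>R h) \<le> 1/2" using pos by (simp add: r_def field_simps)
    moreover have "star (r *\<^sub>R h) = r *\<^sub>R h" by (simp add: star_scaleR sh)
    ultimately obtain s where s: "star s = s" "s * s = 1 - r *\<^sub>R h"
      using selfadjoint_sqrt_one_minus by metis
    have mem: "1 - r *\<^sub>R h \<in> E" using hE by (intro E_closed)
    have "positive_matrix 1 (\<lambda>i j. 1 - r *\<^sub>R h)"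
      unfolding positive_matrix_def using s by (intro exI[of _ "\<lambda>i j. s"]) simp
    then have "positive_matrix 1 (\<lambda>i j. \<kappa> (1 - r *\<^sub>R h))"
      by (subst \<kappa>_positive) (simp_all add: mem)
    then obtain b where "\<kappa> (1 - r *\<^sub>R h) = star b * b"
      unfolding positive_matrix_def by auto
    moreover have "\<kappa> (1 - r *\<^sub>R h) = 1 - r *\<^sub>R \<kappa> h"
      using hE by (simp add: \<kappa>_diff \<kappa>_1 \<kappa>_scaleR E_closed)
    ultimately have "star (1 - r *\<^sub>R \<kappa> h) = 1 - r *\<^sub>R \<kappa> h"
      by (simp add: star_mult star_star)
    then show ?thesis using r by (simp add: star_diff star_scaleR)
  qed
  have "star (\<kappa> (x + star x)) = \<kappa> (x + star x)"
    using assms by (intro sa E_closed) (auto simp: star_add star_star add.commute)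
  then have 1: "star (\<kappa> x) + star (\<kappa> (star x)) = \<kappa> x + \<kappa> (star x)"
    using assms by (simp add: \<kappa>_add E_closed star_add)
  have "star (\<kappa> (\<i> *\<^sub>C (x - star x))) = \<kappa> (\<i> *\<^sub>C (x - star x))"
    using assms by (intro sa E_closed)
      (auto simp: star_scaleC star_diff star_star complex_scaling.scale_right_diff_distrib)
  then have "(- \<i>) *\<^sub>C (star (\<kappa> x) - star (\<kappa> (star x))) = \<i> *\<^sub>C (\<kappa> x - \<kappa> (star x))"
    using assms by (simp add: \<kappa>_scaleC \<kappa>_diff E_closed star_scaleC star_diff)
  then have "\<i> *\<^sub>C (- \<i>) *\<^sub>C (star (\<kappa> x) - star (\<kappa> (star x))) = \<i> *\<^sub>C \<i> *\<^sub>C (\<kappa> x - \<kappa> (star x))"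
    by simp
  then have 2: "star (\<kappa> x) - star (\<kappa> (star x)) = - (\<kappa> x - \<kappa> (star x))"
    by (simp add: scaleC_scaleC scaleC_one)
  have "(star (\<kappa> x) + star (\<kappa> (star x))) + (star (\<kappa> x) - star (\<kappa> (star x)))
      = (\<kappa> x + \<kappa> (star x)) - (\<kappa> x - \<kappa> (star x))"
    unfolding 1 2 by simp
  then have "2 *\<^sub>R star (\<kappa> x) = 2 *\<^sub>R \<kappa> (star x)" by (simp add: scaleR_2)
  then show ?thesis by simp
qed

end

section \<open>The cone of matrices over a \<open>C\<^sup>*\<close>-algebra with positive real part\<close>

definition row_square :: "('x::finite \<Rightarrow> 'b::cstar_algebra) \<Rightarrow> 'b ^ 'x ^ 'x"
  where "row_square c = (\<chi> x y. star (c x) * c y)"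

definition hermitian_double :: "'b::cstar_algebra ^ 'x ^ 'x \<Rightarrow> 'b ^ 'x ^ 'x"
  where "hermitian_double v = (\<chi> x y. v $ x $ y + star (v $ y $ x))"

text \<open>
  Sums of squares of rows serve as the positive matrices, because their closure under sums is
  immediate.  Passing from \<open>v\<close> to \<open>v + v\<^sup>*\<close> makes the cone meaningful on the space of all
  matrices, on which a real functional that is positive on it has to vanish on skew-adjoint
  elements.
\<close>

definition real_part_positive :: "('b::cstar_algebra ^ 'x::finite ^ 'x) set"
  where "real_part_positive = {v. \<exists>cs. hermitian_double v = (\<Sum>c\<leftarrow>cs. row_square c)}"

lemma hermitian_double_add: "hermitian_double (v + w) = hermitian_double v + hermitian_double w"
  by (simp add: hermitian_double_def vec_eq_iff star_add)

lemma hermitian_double_scaleR: "hermitian_double (r *\<^sub>R v) = r *\<^sub>R hermitian_double v"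
  by (simp add: hermitian_double_def vec_eq_iff star_scaleR scaleR_add_right)

lemma convex_cone_real_part_positive:
  "convex_cone (real_part_positive :: ('b::cstar_algebra ^ 'x::finite ^ 'x) set)"
  unfolding convex_cone_iff
proof (intro conjI ballI allI impI)
  show "0 \<in> (real_part_positive :: ('b ^ 'x ^ 'x) set)"
    by (auto simp: real_part_positive_def hermitian_double_def vec_eq_iff intro!: exI[of _ "[]"])
  fix v w :: "'b ^ 'x ^ 'x"
  assume v: "v \<in> real_part_positive"
  then obtain cs where cs: "hermitian_double v = (\<Sum>c\<leftarrow>cs. row_square c)"
    by (auto simp: real_part_positive_def)
  {
    assume "w \<in> real_part_positive"
    then obtain ds where "hermitian_double w = (\<Sum>c\<leftarrow>ds. row_square c)"
      by (auto simp: real_part_positive_def)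
    then have "hermitian_double (v + w) = (\<Sum>c\<leftarrow>cs @ ds. row_square c)"
      using cs by (simp add: hermitian_double_add)
    then show "v + w \<in> real_part_positive" unfolding real_part_positive_def by blast
  }
  fix r :: real assume r: "0 \<le> r"
  have "row_square (\<lambda>x. sqrt r *\<^sub>R c x) = r *\<^sub>R row_square c" for c :: "'x \<Rightarrow> 'b"
    using r by (simp add: row_square_def vec_eq_iff star_scaleR)
  then have "(\<Sum>c\<leftarrow>map (\<lambda>c x. sqrt r *\<^sub>R c x) cs. row_square c) = r *\<^sub>R (\<Sum>c\<leftarrow>cs. row_square c)"
    by (induction cs) (simp_all add: scaleR_add_right)
  then have "hermitian_double (r *\<^sub>R v) = (\<Sum>c\<leftarrow>map (\<lambda>c x. sqrt r *\<^sub>R c x) cs. row_square c)"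
    using cs by (simp add: hermitian_double_scaleR)
  then show "r *\<^sub>R v \<in> real_part_positive" unfolding real_part_positive_def by blast
qed

lemma real_part_positiveI:
  assumes "hermitian_double v = row_square c"
  shows "v \<in> real_part_positive"
  using assms unfolding real_part_positive_def by (auto intro!: exI[of _ "[c]"])

lemma convex_cone_sum:
  assumes "convex_cone C" "\<And>i. i \<in> I \<Longrightarrow> f i \<in> C"
  shows "sum f I \<in> C"
  using assms(2)
  by (induction I rule: infinite_finite_induct)
    (auto intro: convex_cone_add[OF assms(1)] convex_cone_contains_0[OF assms(1)])

lemma axis_axis_nth [simp]:
  "axis x (axis y a) $ z $ w = (if z = x \<and> w = y then a else 0)"
  by (simp add: axis_def)

lemma matrix_axis_expansion:
  "v = (\<Sum>x\<in>UNIV. \<Sum>y\<in>UNIV. axis x (axis y (v $ x $ y)))"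
  for v :: "'b::real_normed_vector ^ 'x::finite ^ 'x"
proof -
  have "(\<Sum>x\<in>UNIV. \<Sum>y\<in>UNIV. if z = x \<and> w = y then v $ x $ y else 0)
     = (\<Sum>x\<in>UNIV. if z = x then v $ z $ w else 0)" for z w
    by (intro sum.cong refl) auto
  then show ?thesis by (simp add: vec_eq_iff)
qed

lemma square_on_diagonal: "axis x (axis x (star a * a)) \<in> real_part_positive"
proof (rule real_part_positiveI)
  define r :: real where "r = sqrt 2"
  have "(r *\<^sub>R star a) * (r *\<^sub>R a) = star a * a + star a * a"
    by (simp add: r_def scaleR_2)
  then show "hermitian_double (axis x (axis x (star a * a)))
      = row_square (\<lambda>z. if z = x then sqrt 2 *\<^sub>R a else 0)"
    by (auto simp: hermitian_double_def row_square_def vec_eq_iff star_scaleR star_mult star_star r_def)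
qed

text \<open>
  The set of dominated matrices is closed under addition, so one entry at a time suffices.  For
  the entry \<open>a\<close> at \<open>(x, y)\<close>, the square of the row with entries \<open>1\<close> at \<open>x\<close> and \<open>a\<close> at \<open>y\<close> bounds
  its real part from below by diagonal terms, which the unit dominates.
\<close>

lemma mat_1_order_unit:
  fixes v :: "'b::cstar_algebra ^ 'x::finite ^ 'x"
  shows "\<exists>t. v + t *\<^sub>R mat 1 \<in> real_part_positive"
proof -
  define dominated where "dominated = {v :: 'b ^ 'x ^ 'x. \<exists>t. v + t *\<^sub>R mat 1 \<in> real_part_positive}"
  note cone = convex_cone_real_part_positive
  have add: "v + w \<in> dominated" if "v \<in> dominated" "w \<in> dominated" for v w
  proof -
    from that obtain s t where "v + s *\<^sub>R mat 1 \<in> real_part_positive" "w + t *\<^sub>R mat 1 \<in> real_part_positive"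
      by (auto simp: dominated_def)
    then have "(v + s *\<^sub>R mat 1) + (w + t *\<^sub>R mat 1) \<in> real_part_positive"
      by (rule convex_cone_add[OF cone])
    then have "v + w + (s + t) *\<^sub>R mat 1 \<in> real_part_positive" by (simp add: algebra_simps)
    then show ?thesis by (auto simp: dominated_def)
  qed
  have sub: "v \<in> dominated" if "v \<in> real_part_positive" for v
    unfolding dominated_def using that by (auto intro!: exI[of _ 0])
  have diag: "- axis x (axis x (star a * a)) \<in> dominated" for x and a :: 'b
  proof -
    obtain s where s: "star s * s = (2 * (norm a)\<^sup>2) *\<^sub>R 1 - star a * a"
      by (rule square_dominated)
    define t where "t = 2 * (norm a)\<^sup>2"
    \<comment> \<open>Subtracting \<open>a\<^sup>* a\<close> at one place of a multiple of the unit leaves a square at each place.\<close>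
    define d where "d z = (if z = x then s else sqrt t *\<^sub>R 1)" for z
    have t: "0 \<le> t" by (simp add: t_def)
    have "(\<Sum>z\<in>UNIV. axis z (axis z (star (d z) * d z))) \<in> real_part_positive"
      by (intro convex_cone_sum[OF cone] square_on_diagonal)
    moreover have "(\<Sum>z\<in>UNIV. axis z (axis z (star (d z) * d z))) = - axis x (axis x (star a * a)) + t *\<^sub>R mat 1"
    proof -
      have "(\<Sum>z\<in>UNIV. axis z (axis z (star (d z) * d z))) $ p $ q
          = (if p = q then star (d p) * d p else 0)" for p q
      proof -
        have "(\<Sum>z\<in>UNIV. if p = z \<and> q = z then star (d z) * d z else 0)
          = (\<Sum>z\<in>UNIV. if p = z then (if p = q then star (d p) * d p else 0) else 0)"
          by (intro sum.cong refl) auto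
        then show ?thesis by simp
      qed
      moreover have "star (d x) * d x = t *\<^sub>R 1 - star a * a" using s by (simp add: d_def t_def)
      moreover have "star (d p) * d p = t *\<^sub>R 1" if "p \<noteq> x" for p
        using that t by (simp add: d_def star_scaleR)
      ultimately show ?thesis
        by (auto simp: vec_eq_iff mat_def simp del: sum_component)
    qed
    ultimately show ?thesis by (auto simp: dominated_def)
  qed
  have single: "axis x (axis y a) \<in> dominated" for x y and a :: 'b
  proof -
    define w where "w = (2 *\<^sub>R axis x (axis y a) + axis x (axis x (star 1 * 1)) + axis y (axis y (star a * a)) :: 'b ^ 'x ^ 'x)"
    have "hermitian_double w = 2 *\<^sub>R row_square (\<lambda>z. (if z = x then 1 else 0) + (if z = y then a else 0))"
      by (simp add: w_def hermitian_double_def row_square_def vec_eq_iff star_add star_mult star_star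
          star_scaleR scaleR_2)
         (auto simp: algebra_simps)
    then have "hermitian_double ((1/2) *\<^sub>R w) = row_square (\<lambda>z. (if z = x then 1 else 0) + (if z = y then a else 0))"
      by (simp add: hermitian_double_scaleR)
    then have "(1/2) *\<^sub>R w \<in> real_part_positive" by (rule real_part_positiveI)
    then have "2 *\<^sub>R (1/2) *\<^sub>R w \<in> real_part_positive" by (intro convex_cone_scaleR[OF cone _ \<open>(1/2) *\<^sub>R w \<in> real_part_positive\<close>]) simp
    then have "w \<in> dominated" by (simp add: sub)
    then have "w + - axis x (axis x (star 1 * 1)) + - axis y (axis y (star a * a)) \<in> dominated"
      by (intro add diag)
    then have "2 *\<^sub>R axis x (axis y a) \<in> dominated" by (simp add: w_def)
    then obtain t where "2 *\<^sub>R axis x (axis y a) + t *\<^sub>R mat 1 \<in> real_part_positive"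
      by (auto simp: dominated_def)
    then have "(1/2) *\<^sub>R (2 *\<^sub>R axis x (axis y a) + t *\<^sub>R mat 1) \<in> real_part_positive"
      by (intro convex_cone_scaleR[OF cone]) auto
    then have "axis x (axis y a) + (t / 2) *\<^sub>R mat 1 \<in> real_part_positive"
      by (simp add: scaleR_add_right)
    then show ?thesis by (auto simp: dominated_def)
  qed
  have 0: "0 \<in> dominated" using sub convex_cone_contains_0[OF cone] by blast
  have sum: "(\<Sum>i\<in>I. F i) \<in> dominated" if "\<And>i. F i \<in> dominated" for F :: "'x \<Rightarrow> 'b ^ 'x ^ 'x" and I
    by (induction I rule: infinite_finite_induct) (auto simp: 0 intro: add that)
  have "v \<in> dominated"
    by (subst matrix_axis_expansion) (intro sum single)
  then show ?thesis by (simp add: dominated_def)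
qed

section \<open>The extended trace form\<close>

lemma sum_rotate:
  "(\<Sum>x\<in>A. \<Sum>y\<in>B. \<Sum>k\<in>K. G x y k) = (\<Sum>k\<in>K. \<Sum>x\<in>A. \<Sum>y\<in>B. G x y k)"
proof -
  have "(\<Sum>x\<in>A. \<Sum>y\<in>B. \<Sum>k\<in>K. G x y k) = (\<Sum>x\<in>A. \<Sum>k\<in>K. \<Sum>y\<in>B. G x y k)"
    by (intro sum.cong refl sum.swap)
  also have "\<dots> = (\<Sum>k\<in>K. \<Sum>x\<in>A. \<Sum>y\<in>B. G x y k)" by (rule sum.swap)
  finally show ?thesis .
qed

lemma sum_cnj_mult:
  "(\<Sum>x\<in>A. \<Sum>y\<in>A. cnj (F x) * F y) = of_real ((cmod (\<Sum>x\<in>A. F x))\<^sup>2)"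
proof -
  have "of_real ((cmod (\<Sum>x\<in>A. F x))\<^sup>2) = cnj (\<Sum>x\<in>A. F x) * (\<Sum>x\<in>A. F x)"
    by (simp only: complex_norm_square mult.commute)
  then show ?thesis by (simp add: sum_product)
qed

context complete_order_embedding begin

definition entries_in_image :: "('b ^ 'x ^ 'x) set"
  where "entries_in_image = {v. \<forall>x y. v $ x $ y \<in> \<kappa> ` E}"

text \<open>
  The real part of the vector functional of \<open>\<Sum> e\<^sub>x \<otimes> e\<^sub>x\<close>, transported along \<open>\<kappa>\<close>.
\<close>

definition trace_form :: "'b ^ 'x ^ 'x \<Rightarrow> real"
  where "trace_form v = Re (\<Sum>x\<in>UNIV. \<Sum>y\<in>UNIV. entry (inv_into E \<kappa> (v $ x $ y)) x y)"

lemma inv_\<kappa>: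
  shows "e \<in> E \<Longrightarrow> inv_into E \<kappa> (\<kappa> e) = e"
    and "a \<in> \<kappa> ` E \<Longrightarrow> b \<in> \<kappa> ` E \<Longrightarrow>
      a + b \<in> \<kappa> ` E \<and> inv_into E \<kappa> (a + b) = inv_into E \<kappa> a + inv_into E \<kappa> b"
    and "a \<in> \<kappa> ` E \<Longrightarrow>
      r *\<^sub>R a \<in> \<kappa> ` E \<and> inv_into E \<kappa> (r *\<^sub>R a) = r *\<^sub>R inv_into E \<kappa> a"
proof -
  show inv: "inv_into E \<kappa> (\<kappa> e) = e" if "e \<in> E" for e
    using that \<kappa>_inj by simp
  show "a + b \<in> \<kappa> ` E \<and> inv_into E \<kappa> (a + b) = inv_into E \<kappa> a + inv_into E \<kappa> b"
    if "a \<in> \<kappa> ` E" "b \<in> \<kappa> ` E"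
    using that by (auto simp: inv E_closed simp flip: \<kappa>_add)
  show "r *\<^sub>R a \<in> \<kappa> ` E \<and> inv_into E \<kappa> (r *\<^sub>R a) = r *\<^sub>R inv_into E \<kappa> a"
    if "a \<in> \<kappa> ` E"
    using that by (auto simp: inv E_closed simp flip: \<kappa>_scaleR)
qed

text \<open>
  A sum of \<open>m\<close> squares of rows is a single square \<open>b\<^sup>* b\<close> of a rectangular matrix.  Padding it
  by zeros to size \<open>m + N\<close> makes it square, and then complete positivity of \<open>\<kappa>\<^sup>-\<^sup>1\<close> at this size
  applies.  It remains to compute that the functional of a positive matrix over \<open>E\<close> is
  a sum of squared moduli.
\<close>

lemma trace_form_positive:
  assumes v: "v \<in> entries_in_image" "v \<in> real_part_positive"
  shows "0 \<le> trace_form v"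
proof -
  obtain cs where cs: "hermitian_double v = (\<Sum>c\<leftarrow>cs. row_square c)"
    using v(2) by (auto simp: real_part_positive_def)
  define m where "m = length cs"
  define N where "N = CARD('x)"
  obtain f where f: "bij_betw f {0..<N} (UNIV :: 'x set)"
    using ex_bij_betw_nat_finite[of "UNIV :: 'x set"] unfolding N_def by auto
  define g where "g = inv_into {0..<N} f"
  have fg: "f (g x) = x" and gN: "g x < N" for x
    using bij_betw_inv_into_right[OF f] inv_into_into[of x f "{0..<N}"] f
    by (auto simp: g_def bij_betw_def)
  define a where "a x y = inv_into E \<kappa> (v $ x $ y)" for x y
  have aE: "a x y \<in> E" and \<kappa>a: "\<kappa> (a x y) = v $ x $ y" for x y
    using v(1) unfolding entries_in_image_def a_def
    by (auto intro: inv_into_into f_inv_into_f)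
  define h where "h x y = a x y + star (a y x)" for x y
  have hE: "h x y \<in> E" for x y unfolding h_def by (intro E_closed aE)
  have \<kappa>h: "\<kappa> (h x y) = (\<Sum>k<m. star ((cs ! k) x) * (cs ! k) y)" for x y
  proof -
    have "\<kappa> (h x y) = hermitian_double v $ x $ y"
      by (simp add: h_def \<kappa>_add \<kappa>_star aE E_closed \<kappa>a hermitian_double_def)
    also have "\<dots> = (\<Sum>k<m. row_square (cs ! k) $ x $ y)"
      unfolding cs by (simp add: sum_list_sum_nth m_def atLeast0LessThan)
    finally show ?thesis by (simp add: row_square_def)
  qed
  \<comment> \<open>The matrix \<open>v + v\<^sup>*\<close> pulled back to \<open>E\<close>, indexed by numbers and padded by zeros.\<close>
  define X where "X i j = (if i < N \<and> j < N then h (f i) (f j) else 0)" for i j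
  have XE: "X i j \<in> E" for i j by (simp add: X_def hE E_closed)
  have "positive_matrix (m + N) (\<lambda>i j. \<kappa> (X i j))"
    unfolding positive_matrix_def
  proof (intro exI[of _ "\<lambda>k i. if k < m \<and> i < N then (cs ! k) (f i) else 0"] allI impI)
    fix i j
    let ?b = "\<lambda>k i. if k < m \<and> i < N then (cs ! k) (f i) else 0"
    have "(\<Sum>k<m + N. star (?b k i) * ?b k j) = (\<Sum>k<m. star (?b k i) * ?b k j)"
      by (intro sum.mono_neutral_right) auto
    also have "\<dots> = \<kappa> (X i j)"
      by (auto simp: X_def \<kappa>_0 \<kappa>h intro!: sum.cong sum.neutral)
    finally show "\<kappa> (X i j) = (\<Sum>k<m + N. star (?b k i) * ?b k j)" ..
  qed
  then have "positive_matrix (m + N) X" using \<kappa>_positive[of "m + N" X] XE by simp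
  then obtain c where c: "\<And>i j. i < m + N \<Longrightarrow> j < m + N \<Longrightarrow>
      X i j = (\<Sum>k<m + N. star (c k i) * c k j)"
    unfolding positive_matrix_def by blast
  define d where "d k x = c k (g x)" for k x
  have h: "h x y = (\<Sum>k<m + N. star (d k x) * d k y)" for x y
    using c[of "g x" "g y"] gN[of x] gN[of y] by (simp add: X_def fg d_def)
  have "(\<Sum>x\<in>UNIV. \<Sum>y\<in>UNIV. entry (h x y) x y)
      = (\<Sum>x\<in>UNIV. \<Sum>y\<in>UNIV. \<Sum>k<m + N. \<Sum>z\<in>UNIV. cnj (entry (d k x) z x) * entry (d k y) z y)"
    by (simp add: h entry_sum entry_mult)
  also have "\<dots> = (\<Sum>k<m + N. \<Sum>z\<in>UNIV. \<Sum>x\<in>UNIV. \<Sum>y\<in>UNIV. cnj (entry (d k x) z x) * entry (d k y) z y)"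
    by (subst sum_rotate) (intro sum.cong refl sum_rotate)
  also have "\<dots> = (\<Sum>k<m + N. \<Sum>z\<in>UNIV. of_real ((cmod (\<Sum>x\<in>UNIV. entry (d k x) z x))\<^sup>2))"
    by (intro sum.cong refl sum_cnj_mult)
  finally have "0 \<le> Re (\<Sum>x\<in>UNIV. \<Sum>y\<in>UNIV. entry (h x y) x y)"
    by (simp add: sum_nonneg)
  moreover have "(\<Sum>x\<in>UNIV. \<Sum>y\<in>UNIV. entry (h x y) x y)
      = (\<Sum>x\<in>UNIV. \<Sum>y\<in>UNIV. entry (a x y) x y) + cnj (\<Sum>x\<in>UNIV. \<Sum>y\<in>UNIV. entry (a x y) x y)"
  proof -
    have "(\<Sum>x\<in>UNIV. \<Sum>y\<in>UNIV. cnj (entry (a y x) y x)) = (\<Sum>x\<in>UNIV. \<Sum>y\<in>UNIV. cnj (entry (a x y) x y))"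
      by (rule sum.swap)
    then show ?thesis by (simp add: h_def sum.distrib)
  qed
  ultimately show ?thesis by (simp add: trace_form_def a_def)
qed

text \<open>
  The entries \<open>g x y\<close> are the coordinates of the extended functional, and the last property
  says that \<open>g\<close> is the real part of a completely positive extension of \<open>\<kappa>\<^sup>-\<^sup>1\<close>.
\<close>

lemma positive_form_exists:
  obtains g :: "'x \<Rightarrow> 'x \<Rightarrow> 'b \<Rightarrow> real" where
    "\<And>x y. linear (g x y)"
    "\<And>c. 0 \<le> (\<Sum>x\<in>UNIV. \<Sum>y\<in>UNIV. g x y (star (c x) * c y))"
    "\<And>x y a. g x y (star a) = g y x a"
    "\<And>x y e. e \<in> E \<Longrightarrow> g x y (\<kappa> e) = Re (entry e x y)"
proof -
  let ?S = "entries_in_image"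
  have inv0: "inv_into E \<kappa> 0 = 0" using inv_\<kappa>(1)[of 0] by (simp add: \<kappa>_0 E_closed)
  have "subspace ?S"
    unfolding subspace_def entries_in_image_def
    using inv_\<kappa>(2,3) image_eqI[of 0 \<kappa> 0 E] by (auto simp: \<kappa>_0 E_closed)
  moreover have id: "mat 1 \<in> ?S"
    using image_eqI[of 0 \<kappa> 0 E] image_eqI[of 1 \<kappa> 1 E]
    by (auto simp: entries_in_image_def mat_def \<kappa>_0 \<kappa>_1 E_closed)
  moreover have "trace_form (v + w) = trace_form v + trace_form w" if "v \<in> ?S" "w \<in> ?S" for v w
    using that by (simp add: trace_form_def entries_in_image_def inv_\<kappa>(2) sum.distrib)
  moreover have "trace_form (r *\<^sub>R v) = r * trace_form v" if "v \<in> ?S" for v r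
    using that by (simp add: trace_form_def entries_in_image_def inv_\<kappa>(3) sum_distrib_left)
  moreover have "0 < trace_form (mat 1)"
  proof -
    have "inv_into E \<kappa> 1 = 1" using inv_\<kappa>(1)[of 1] by (simp add: \<kappa>_1 E_closed)
    then have "trace_form (mat 1) = (\<Sum>x\<in>(UNIV::'x set). 1)"
      unfolding trace_form_def Re_sum
      by (intro sum.cong refl)
        (simp add: mat_def if_distrib[of "inv_into E \<kappa>"] if_distrib[of "\<lambda>A. entry A _ _"] inv0 entry_1 if_distrib[of Re] cong: if_cong)
    then show ?thesis by simp
  qed
  ultimately obtain f where f: "linear f" "\<And>v. v \<in> real_part_positive \<Longrightarrow> 0 \<le> f v"
      "\<And>v. v \<in> ?S \<Longrightarrow> f v = trace_form v"
    using positive_functional_extension[OF convex_cone_real_part_positive, of ?S "mat 1" trace_form]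
      mat_1_order_unit trace_form_positive by blast
  define g where "g x y a = f (axis x (axis y a))" for x y a
  have ax: "axis x (axis y (a + b)) = axis x (axis y a) + axis x (axis y b)"
    "axis x (axis y (r *\<^sub>R a)) = r *\<^sub>R axis x (axis y a)" for x y :: 'x and a b :: 'b and r
    by (simp_all add: vec_eq_iff)
  have fg: "f v = (\<Sum>x\<in>UNIV. \<Sum>y\<in>UNIV. g x y (v $ x $ y))" for v
    by (subst matrix_axis_expansion) (simp add: linear_sum[OF f(1)] g_def)
  show thesis
  proof
    show "linear (g x y)" for x y
      by (intro linearI) (simp_all add: g_def ax linear_add[OF f(1)] linear_cmul[OF f(1)])
    show "0 \<le> (\<Sum>x\<in>UNIV. \<Sum>y\<in>UNIV. g x y (star (c x) * c y))" for c
    proof -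
      have "hermitian_double (row_square c) = row_square (\<lambda>x. sqrt 2 *\<^sub>R c x)"
        by (simp add: hermitian_double_def row_square_def vec_eq_iff star_mult star_star star_scaleR scaleR_2)
      then have "0 \<le> f (row_square c)" by (intro f(2) real_part_positiveI)
      then show ?thesis by (simp add: fg row_square_def)
    qed
    show "g x y (star a) = g y x a" for x y a
    proof -
      define v where "v = axis x (axis y (star a)) - axis y (axis x a)"
      have vpq: "v $ p $ q = (if p = x \<and> q = y then star a else 0) - (if p = y \<and> q = x then a else 0)"
        for p q by (simp add: v_def)
      have v0: "hermitian_double v = 0"
        unfolding hermitian_double_def vec_eq_iff
        by (simp only: vec_lambda_beta vpq star_diff if_distrib[of star] star_star star_0 zero_index)
          (simp add: conj_commute)
      then have "hermitian_double ((- 1) *\<^sub>R v) = 0" by (simp only: hermitian_double_scaleR scaleR_zero_right)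
      moreover have "row_square (\<lambda>_. 0) = (0 :: 'b ^ 'x ^ 'x)" by (simp add: row_square_def vec_eq_iff)
      ultimately have "hermitian_double v = row_square (\<lambda>_. 0)" "hermitian_double (- v) = row_square (\<lambda>_. 0)"
        using v0 by simp_all
      then have "0 \<le> f v" "0 \<le> f (- v)" by (auto intro: f(2) real_part_positiveI)
      then have "f v = 0" using linear_neg[OF f(1)] by simp
      then show ?thesis by (simp add: v_def g_def linear_diff[OF f(1)])
    qed
    show "g x y (\<kappa> e) = Re (entry e x y)" if e: "e \<in> E" for x y e
    proof -
      have "axis x (axis y (\<kappa> e)) \<in> ?S"
        using e image_eqI[of 0 \<kappa> 0 E] by (auto simp: entries_in_image_def \<kappa>_0 E_closed)
      then have "g x y (\<kappa> e) = trace_form (axis x (axis y (\<kappa> e)))" by (simp add: g_def f(3))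
      also have "\<dots> = Re (\<Sum>p\<in>UNIV. \<Sum>q\<in>UNIV. if p = x \<and> q = y then entry e x y else 0)"
        unfolding trace_form_def
        by (intro arg_cong[where f=Re] sum.cong refl) (auto simp: inv0 inv_\<kappa>(1) e)
      also have "\<dots> = Re (\<Sum>p\<in>UNIV. if p = x then entry e x y else 0)"
        by (intro arg_cong[where f=Re] sum.cong refl) auto
      finally show ?thesis by simp
    qed
  qed
qed

end

section \<open>The representation defined by a positive form\<close>

locale positive_form = complete_order_embedding E \<kappa>
  for E :: "'x::finite ell2_op set" and \<kappa> :: "'x ell2_op \<Rightarrow> 'b::cstar_algebra" +
  fixes g :: "'x \<Rightarrow> 'x \<Rightarrow> 'b \<Rightarrow> real"
  assumes g_linear: "linear (g x y)"
    and g_positive: "0 \<le> (\<Sum>x\<in>UNIV. \<Sum>y\<in>UNIV. g x y (star (c x) * c y))"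
    and g_star: "g x y (star a) = g y x a"
    and g_\<kappa>: "e \<in> E \<Longrightarrow> g x y (\<kappa> e) = Re (entry e x y)"
begin

lemmas g_simps = linear_add[OF g_linear] linear_diff[OF g_linear] linear_cmul[OF g_linear]
  linear_0[OF g_linear] linear_neg[OF g_linear] linear_sum[OF g_linear]

text \<open>
  Stinespring's semi-inner product on \<open>B \<otimes> \<complex>\<^sup>X\<close>, real part only.  Complex scalars act as elements
  of \<open>B\<close>, so nothing is lost.
\<close>

definition form :: "('x \<Rightarrow> 'b) \<Rightarrow> ('x \<Rightarrow> 'b) \<Rightarrow> real"
  where "form v w = (\<Sum>x\<in>UNIV. \<Sum>y\<in>UNIV. g x y (star (v x) * w y))"

definition null :: "('x \<Rightarrow> 'b) \<Rightarrow> bool"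
  where "null v \<longleftrightarrow> form v v = 0"

abbreviation single :: "'x \<Rightarrow> 'b \<Rightarrow> 'x \<Rightarrow> 'b"
  where "single y b \<equiv> (\<lambda>x. if x = y then b else 0)"

lemma form_nonneg: "0 \<le> form v v"
  unfolding form_def by (rule g_positive)

lemma form_commute: "form v w = form w v"
proof -
  have "g x y (star (v x) * w y) = g y x (star (w y) * v x)" for x y
    using g_star[of y x "star (v x) * w y"] by (simp add: star_mult star_star)
  then show ?thesis unfolding form_def by (subst sum.swap) simp
qed

lemma form_add_left: "form (\<lambda>x. u x + v x) w = form u w + form v w"
  and form_add_right: "form w (\<lambda>x. u x + v x) = form w u + form w v"
  and form_diff_left: "form (\<lambda>x. u x - v x) w = form u w - form v w"
  and form_diff_right: "form w (\<lambda>x. u x - v x) = form w u - form w v"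
  and form_scale_left: "form (\<lambda>x. r *\<^sub>R u x) w = r * form u w"
  and form_scale_right: "form w (\<lambda>x. r *\<^sub>R u x) = r * form w u"
  by (simp_all add: form_def star_add star_diff star_scaleR g_simps algebra_simps sum.distrib
      sum_subtractf sum_distrib_left)

lemma form_mult: "form (\<lambda>x. c * v x) w = form v (\<lambda>x. star c * w x)"
  by (simp add: form_def star_mult mult.assoc)

lemma form_single: "form (single x a) (single y b) = g x y (star a * b)"
proof -
  have "form (single x a) (single y b)
      = (\<Sum>p\<in>UNIV. \<Sum>q\<in>UNIV. if q = y then (if p = x then g x y (star a * b) else 0) else 0)"
    unfolding form_def by (intro sum.cong refl) (simp add: g_simps)
  then show ?thesis by simp
qed

text \<open>
  The case of a null vector in the Cauchy--Schwarz inequality: a quadratic polynomial in \<open>t\<close> with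
  leading coefficient zero is nonnegative only if it is constant.
\<close>

lemma null_form:
  assumes "null v"
  shows "form v w = 0"
proof (rule ccontr)
  assume ne: "form v w \<noteq> 0"
  \<comment> \<open>For this \<open>t\<close> the form of \<open>t v + w\<close> is \<open>-1\<close>.\<close>
  define t where "t = - (form w w + 1) / (2 * form v w)"
  have "0 \<le> form (\<lambda>x. t *\<^sub>R v x + w x) (\<lambda>x. t *\<^sub>R v x + w x)" by (rule form_nonneg)
  also have "\<dots> = 2 * t * form v w + form w w"
    using assms form_commute[of w v] by (simp add: form_add_left form_add_right form_scale_left form_scale_right null_def)
  also have "\<dots> = - 1" using ne by (simp add: t_def field_simps)
  finally show False by simp
qed

lemma null_add: "null u \<Longrightarrow> null v \<Longrightarrow> null (\<lambda>x. u x + v x)"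
  using null_form[of u] null_form[of v] by (simp add: null_def form_add_left)

lemma null_diff: "null u \<Longrightarrow> null v \<Longrightarrow> null (\<lambda>x. u x - v x)"
  using null_form[of u] null_form[of v] by (simp add: null_def form_diff_left)

lemma null_mult: "null v \<Longrightarrow> null (\<lambda>x. c * v x)"
  using null_form[of v] by (simp add: null_def form_mult)

lemma null_zero: "null (\<lambda>x. 0)"
  by (simp add: null_def form_def g_simps)

lemma null_sum: "(\<And>i. i \<in> I \<Longrightarrow> null (v i)) \<Longrightarrow> null (\<lambda>x. \<Sum>i\<in>I. v i x)"
  by (induction I rule: infinite_finite_induct) (simp_all add: null_zero null_add)

lemma null_scaleC: "null v \<Longrightarrow> null (\<lambda>x. c *\<^sub>C v x)"
  using null_mult[of v "c *\<^sub>C 1"] by (simp add: mult_scaleC_left)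

text \<open>
  Positivity on \<open>1 \<otimes> e\<^sub>x - a \<otimes> e\<^sub>y\<close> bounds \<open>g x y a\<close> by \<open>g y y (a\<^sup>* a)\<close>, which is at most
  \<open>2 (norm a)\<^sup>2\<close> by \<open>square_dominated\<close>.
\<close>

lemma g_bounded: "bounded_linear (g x y)"
proof -
  have g1: "g x y 1 = (if x = y then 1 else 0)" for x y
    using g_\<kappa>[of 1 x y] by (simp add: \<kappa>_1 E_closed entry_1)
  have sq: "g y y (star a * a) \<le> 2 * (norm a)\<^sup>2" for y a
  proof -
    obtain s where s: "star s * s = (2 * (norm a)\<^sup>2) *\<^sub>R 1 - star a * a"
      by (rule square_dominated)
    have "0 \<le> form (single y s) (single y s)" by (rule form_nonneg)
    then show ?thesis by (simp only: form_single s g_simps g1 if_True refl real_scaleR_def)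
  qed
  have unit: "g x y a \<le> 2" if "norm a \<le> 1" for a
  proof -
    define w where "w p = single x 1 p - single y a p" for p
    have "0 \<le> form w w" by (rule form_nonneg)
    also have "form w w = g x x 1 + g y y (star a * a) - 2 * g x y a"
      using g_star[of y x a] unfolding w_def
      by (simp add: form_diff_left form_diff_right form_single)
    also have "\<dots> \<le> 1 + 2 * 1 - 2 * g x y a"
      using sq[of y a] that power_mono[of "norm a" 1 2] by (simp add: g1)
    finally show ?thesis by simp
  qed
  show ?thesis
  proof (rule bounded_linear_intro[where K=2])
    show "norm (g x y a) \<le> norm a * 2" for a
    proof (cases "a = 0")
      case False
      have "g x y ((1 / norm a) *\<^sub>R a) \<le> 2" "g x y ((1 / norm a) *\<^sub>R (- a)) \<le> 2"
        by (rule unit, simp)+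
      then have "g x y a / norm a \<le> 2" "- g x y a / norm a \<le> 2"
        by (simp_all only: g_simps) simp_all
      then show ?thesis using False by (simp add: field_simps abs_le_iff)
    qed (simp add: g_simps)
  qed (simp_all add: g_simps)
qed

text \<open>
  Modulo null vectors, \<open>b\<close> acts on the copy of \<open>\<complex>\<^sup>X\<close> spanned by the vectors \<open>1 \<otimes> e\<^sub>y\<close> as the
  matrix \<open>A\<close>; in particular it leaves this copy invariant.
\<close>

definition rep :: "'b \<Rightarrow> 'x ell2_op \<Rightarrow> bool"
  where "rep b A \<longleftrightarrow> (\<forall>y. null (\<lambda>x. single y b x - entry A x y *\<^sub>C 1))"

lemma null_cong: "null u \<Longrightarrow> (\<And>x. u x = v x) \<Longrightarrow> null v"
  by (metis ext)

lemma rep_add: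
  assumes "rep a A" "rep b B"
  shows "rep (a + b) (A + B)"
  unfolding rep_def
proof
  fix y
  show "null (\<lambda>x. single y (a + b) x - entry (A + B) x y *\<^sub>C 1)"
    using null_add[OF assms(1)[unfolded rep_def, rule_format, of y] assms(2)[unfolded rep_def, rule_format, of y]]
    by (rule null_cong) (auto simp: scaleC_add_left)
qed

lemma rep_scaleC:
  assumes "rep a A"
  shows "rep (c *\<^sub>C a) (c *\<^sub>C A)"
  unfolding rep_def
proof
  fix y
  show "null (\<lambda>x. single y (c *\<^sub>C a) x - entry (c *\<^sub>C A) x y *\<^sub>C 1)"
    using null_scaleC[OF assms[unfolded rep_def, rule_format, of y], of c]
    by (rule null_cong) (auto simp: complex_scaling.scale_right_diff_distrib scaleC_scaleC)
qed

lemma rep_mult: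
  assumes A: "rep a A" and B: "rep b B"
  shows "rep (a * b) (A * B)"
  unfolding rep_def
proof
  fix y
  \<comment> \<open>The error \<open>a b \<xi>\<^sub>y - (A B) \<xi>\<^sub>y\<close> splits as \<open>a (b \<xi>\<^sub>y - B \<xi>\<^sub>y) + \<Sum>\<^sub>z B\<^sub>z\<^sub>y (a \<xi>\<^sub>z - A \<xi>\<^sub>z)\<close>.\<close>
  have "null (\<lambda>x. a * (single y b x - entry B x y *\<^sub>C 1)
      + (\<Sum>z\<in>UNIV. entry B z y *\<^sub>C (single z a x - entry A x z *\<^sub>C 1)))"
    using A B unfolding rep_def by (intro null_add null_mult null_sum null_scaleC) auto
  then show "null (\<lambda>x. single y (a * b) x - entry (A * B) x y *\<^sub>C 1)"
  proof (rule null_cong)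
    fix x
    have "(\<Sum>z\<in>UNIV. entry B z y *\<^sub>C (single z a x - entry A x z *\<^sub>C 1))
        = (\<Sum>z\<in>UNIV. if x = z then entry B x y *\<^sub>C a else 0)
          - (\<Sum>z\<in>UNIV. (entry A x z * entry B z y) *\<^sub>C 1)"
      unfolding sum_subtractf[symmetric]
      by (intro sum.cong refl)
        (auto simp: complex_scaling.scale_right_diff_distrib scaleC_scaleC mult.commute)
    also have "\<dots> = entry B x y *\<^sub>C a - entry (A * B) x y *\<^sub>C 1"
      by (simp add: entry_mult complex_scaling.scale_sum_left)
    finally show "a * (single y b x - entry B x y *\<^sub>C 1)
        + (\<Sum>z\<in>UNIV. entry B z y *\<^sub>C (single z a x - entry A x z *\<^sub>C 1))
        = single y (a * b) x - entry (A * B) x y *\<^sub>C 1"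
      by (simp add: right_diff_distrib mult_scaleC_right)
  qed
qed

text \<open>
  The vectors \<open>1 \<otimes> e\<^sub>x\<close> are orthonormal, which is what makes the representing matrix unique.
\<close>

lemma form_single_const: "form (single x 1) (\<lambda>z. c z *\<^sub>C 1) = Re (c x)"
proof -
  have gz: "g x z (c z *\<^sub>C 1) = (if z = x then Re (c x) else 0)" for z
    using g_\<kappa>[of "c z *\<^sub>C 1" x z] by (simp add: \<kappa>_scaleC \<kappa>_1 E_closed entry_1)
  have "form (single x 1) (\<lambda>z. c z *\<^sub>C 1)
      = (\<Sum>p\<in>UNIV. if p = x then (\<Sum>z\<in>UNIV. g x z (c z *\<^sub>C 1)) else 0)"
    unfolding form_def by (intro sum.cong refl) (simp add: g_simps)
  then show ?thesis by (simp add: gz)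
qed

lemma rep_Re:
  assumes "rep b A"
  shows "g x y b = Re (entry A x y)"
proof -
  have "form (\<lambda>p. single y b p - entry A p y *\<^sub>C 1) (single x 1) = 0"
    using assms by (intro null_form) (simp add: rep_def)
  then have "form (single x 1) (\<lambda>p. single y b p - entry A p y *\<^sub>C 1) = 0"
    by (simp add: form_commute)
  then show ?thesis
    by (simp add: form_diff_right form_single_const form_single)
qed

text \<open>
  The real form \<open>g\<close> is the real part of the matrix coefficient; its imaginary part is recovered
  from \<open>\<i> b\<close>.
\<close>

definition \<rho> :: "'b \<Rightarrow> 'x ell2_op"
  where "\<rho> b = op_of_mat (\<chi> x y. Complex (g x y b) (- g x y (\<i> *\<^sub>C b)))"

lemma rep_unique:
  assumes "rep b A"
  shows "\<rho> b = A"
proof (rule op_eqI)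
  fix x y
  have "g x y (\<i> *\<^sub>C b) = - Im (entry A x y)"
    using rep_Re[OF rep_scaleC[OF assms, of \<i>], of x y] by simp
  with rep_Re[OF assms, of x y] show "entry (\<rho> b) x y = entry A x y"
    by (simp add: \<rho>_def complex_eq_iff)
qed

lemma \<rho>_star: "\<rho> (star b) = star (\<rho> b)"
proof (rule op_eqI)
  fix x y
  have "\<i> *\<^sub>C star b = star (- (\<i> *\<^sub>C b))"
    by (simp add: star_minus star_scaleC)
  then have "g x y (\<i> *\<^sub>C star b) = - g y x (\<i> *\<^sub>C b)"
    by (simp only: g_star g_simps)
  then show "entry (\<rho> (star b)) x y = entry (star (\<rho> b)) x y"
    by (simp add: \<rho>_def g_star complex_eq_iff)
qed

text \<open>
  Invariance is required of \<open>star b\<close> as well, because the elements that leave a subspace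
  invariant need not be closed under the adjoint.
\<close>

definition represented :: "'b set"
  where "represented = {b. rep b (\<rho> b) \<and> rep (star b) (\<rho> (star b))}"

lemma represented_iff: "b \<in> represented \<longleftrightarrow> (\<exists>A B. rep b A \<and> rep (star b) B)"
  unfolding represented_def using rep_unique by auto

text \<open>
  Stated with \<open>\<rho> b\<close> as the representing matrix, invariance is an equation between continuous
  functions of \<open>b\<close>.
\<close>

lemma closed_represented: "closed represented"
proof -
  have cg: "continuous_on UNIV (\<lambda>b. g x y (h b))" if "continuous_on UNIV h" for x y and h :: "'b \<Rightarrow> 'b"
    using bounded_linear.continuous_on[OF g_bounded that] .
  have cs: "continuous_on UNIV (\<lambda>b. star (h b))" if "continuous_on UNIV h" for h :: "'b \<Rightarrow> 'b"
    using bounded_linear.continuous_on[OF bounded_linear_star that] .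
  have c\<rho>: "continuous_on UNIV (\<lambda>b. entry (\<rho> (h b)) x y *\<^sub>C (1 :: 'b))"
    if h: "continuous_on UNIV h" for x y and h :: "'b \<Rightarrow> 'b"
  proof -
    have "entry (\<rho> (h b)) x y *\<^sub>C (1 :: 'b)
        = g x y (h b) *\<^sub>R 1 + (- g x y ((\<i> *\<^sub>C 1) * h b)) *\<^sub>R (\<i> *\<^sub>C 1)" for b
      by (simp add: \<rho>_def Complex_eq scaleC_add_left complex_scaling.scale_left_diff_distrib
          scaleR_scaleC scaleC_scaleC mult.commute mult_scaleC_left)
    moreover have "continuous_on UNIV (\<lambda>b. g x y (h b) *\<^sub>R (1 :: 'b)
        + (- g x y ((\<i> *\<^sub>C 1) * h b)) *\<^sub>R (\<i> *\<^sub>C 1))"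
      by (intro continuous_on_add continuous_on_scaleR continuous_on_minus cg continuous_on_mult
          continuous_on_const h)
    ultimately show ?thesis by simp
  qed
  have cw: "continuous_on UNIV (\<lambda>b. single y (h b) x - entry (\<rho> (h b)) x y *\<^sub>C 1)"
    if h: "continuous_on UNIV h" for x y and h :: "'b \<Rightarrow> 'b"
    using h by (cases "x = y") (simp_all add: continuous_on_diff c\<rho>[OF h] continuous_on_minus)
  have crep: "closed {b. rep (h b) (\<rho> (h b))}" if h: "continuous_on UNIV h" for h :: "'b \<Rightarrow> 'b"
    unfolding rep_def null_def form_def
    by (intro closed_Collect_all closed_Collect_eq continuous_on_sum cg continuous_on_mult cs
        cw[OF h] continuous_on_const)
  have "closed ({b. rep b (\<rho> b)} \<inter> {b. rep (star b) (\<rho> (star b))})"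
    by (intro closed_Int crep cs continuous_on_id)
  then show ?thesis by (simp add: represented_def Collect_conj_eq)
qed

lemma rep_0: "rep 0 0"
  using null_zero by (simp add: rep_def)

lemma cstar_subalgebra_represented: "cstar_subalgebra represented"
  unfolding cstar_subalgebra_def complex_scaling.subspace_def
proof (intro conjI ballI allI closed_represented)
  show "0 \<in> represented" unfolding represented_iff using rep_0 by auto
  show "a + b \<in> represented" if "a \<in> represented" "b \<in> represented" for a b
    using that unfolding represented_iff star_add by (meson rep_add)
  show "a * b \<in> represented" if "a \<in> represented" "b \<in> represented" for a b
    using that unfolding represented_iff star_mult by (meson rep_mult)
  show "c *\<^sub>C a \<in> represented" if "a \<in> represented" for a c
    using that unfolding represented_iff star_scaleC by (meson rep_scaleC)
  show "star a \<in> represented" if "a \<in> represented" for a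
    using that unfolding represented_iff star_star by blast
qed

lemma star_homomorphism_\<rho>:
  assumes "represented = UNIV"
  shows "star_homomorphism \<rho>"
proof -
  have r: "rep b (\<rho> b)" for b using assms by (auto simp: represented_def)
  show ?thesis
    unfolding star_homomorphism_def
    using rep_unique[OF rep_add[OF r r]] rep_unique[OF rep_scaleC[OF r]] rep_unique[OF rep_mult[OF r r]]
    by (simp add: \<rho>_star)
qed

lemma unit_block:
  assumes xx: "matrix_unit x x \<in> E" and xy: "matrix_unit x y \<in> E"
    and yx: "matrix_unit y x \<in> E" and yy: "matrix_unit y y \<in> E"
  obtains a b :: "nat \<Rightarrow> 'b" where
    "\<kappa> (matrix_unit x x) = (\<Sum>k<2. star (a k) * a k)"
    "\<kappa> (matrix_unit x y) = (\<Sum>k<2. star (a k) * b k)"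
    "\<kappa> (matrix_unit y y) = (\<Sum>k<2. star (b k) * b k)"
proof -
  have "positive_matrix 2 (\<lambda>i j. \<kappa> (matrix_unit (if i = 0 then x else y) (if j = 0 then x else y)))"
    by (subst \<kappa>_positive) (auto simp: assms positive_matrix_unit_block)
  then obtain c :: "nat \<Rightarrow> nat \<Rightarrow> 'b" where c: "\<And>i j :: nat. i < 2 \<Longrightarrow> j < 2 \<Longrightarrow>
      \<kappa> (matrix_unit (if i = 0 then x else y) (if j = 0 then x else y))
        = (\<Sum>k<2. star (c k i) * c k j)"
    unfolding positive_matrix_def by blast
  from that[of "\<lambda>k. c k 0" "\<lambda>k. c k 1"] c[of 0 0] c[of 0 1] c[of 1 1] show thesis by simp
qed

lemma null_single_squares:
  assumes "finite K" "(\<Sum>k\<in>K. g z z (star (b k) * b k)) = 0" "k \<in> K"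
  shows "null (single z (b k))"
proof -
  have "g z z (star (b k) * b k) = 0"
    using sum_nonneg_0[OF assms(1) _ assms(2) assms(3)] form_nonneg[of "single z (b _)"]
    by (simp add: form_single)
  then show ?thesis by (simp add: null_def form_single)
qed

text \<open>
  Factor the positive block of the edge as \<open>p\<^sub>x = \<Sum> a\<^sub>k\<^sup>* a\<^sub>k\<close>, \<open>u = \<Sum> a\<^sub>k\<^sup>* b\<^sub>k\<close>, \<open>p\<^sub>y = \<Sum> b\<^sub>k\<^sup>* b\<^sub>k\<close>,
  where \<open>p\<^sub>x, u, p\<^sub>y\<close> are the images of \<open>e\<^sub>x\<^sub>x, e\<^sub>x\<^sub>y, e\<^sub>y\<^sub>y\<close>, and let \<open>\<xi>\<^sub>z = 1 \<otimes> e\<^sub>z\<close>.  For \<open>z \<noteq> y\<close> the form of \<open>p\<^sub>y\<close>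
  at \<open>\<xi>\<^sub>z\<close> is zero, so each \<open>b\<^sub>k \<xi>\<^sub>z\<close> is null and \<open>u \<xi>\<^sub>z\<close> is null.  For \<open>z = y\<close>, the families \<open>a\<^sub>k \<xi>\<^sub>x\<close>
  and \<open>b\<^sub>k \<xi>\<^sub>y\<close> have total norm \<open>1\<close> and total inner product \<open>1\<close>, so they agree modulo null
  vectors; hence \<open>u \<xi>\<^sub>y = p\<^sub>x \<xi>\<^sub>x\<close>, and this is \<open>\<xi>\<^sub>x\<close> since the \<open>p\<^sub>z\<close> sum to \<open>1\<close> and the others
  kill \<open>\<xi>\<^sub>x\<close>.
\<close>

lemma rep_matrix_unit:
  assumes diag: "\<And>z. matrix_unit z z \<in> E"
    and xy: "matrix_unit x y \<in> E" and yx: "matrix_unit y x \<in> E"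
  shows "rep (\<kappa> (matrix_unit x y)) (matrix_unit x y)"
proof -
  have off: "null (single z (\<kappa> (matrix_unit x y)))"
    if z: "z \<noteq> y" and xy: "matrix_unit x y \<in> E" and yx: "matrix_unit y x \<in> E" for x y z
  proof -
    obtain a b :: "nat \<Rightarrow> 'b" where "\<kappa> (matrix_unit x x) = (\<Sum>k<2. star (a k) * a k)"
        and ab: "\<kappa> (matrix_unit x y) = (\<Sum>k<2. star (a k) * b k)"
        "\<kappa> (matrix_unit y y) = (\<Sum>k<2. star (b k) * b k)"
      by (rule unit_block[OF diag xy yx diag])
    have "g z z (\<kappa> (matrix_unit y y)) = 0"
      using z by (simp add: g_\<kappa> diag entry_matrix_unit)
    then have "(\<Sum>k<2. g z z (star (b k) * b k)) = 0" by (simp add: ab g_simps)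
    then have "null (single z (b k))" if "k < 2" for k
      using that by (intro null_single_squares[of "{..<2}" z b k]) auto
    then have "null (\<lambda>p. \<Sum>k<2. star (a k) * single z (b k) p)"
      by (intro null_sum null_mult) auto
    then show ?thesis by (rule null_cong) (simp add: ab)
  qed
  have on: "null (\<lambda>p. single y (\<kappa> (matrix_unit x y)) p - single x 1 p)"
  proof -
    obtain a b :: "nat \<Rightarrow> 'b" where ab: "\<kappa> (matrix_unit x x) = (\<Sum>k<2. star (a k) * a k)"
        "\<kappa> (matrix_unit x y) = (\<Sum>k<2. star (a k) * b k)"
        "\<kappa> (matrix_unit y y) = (\<Sum>k<2. star (b k) * b k)"
      by (rule unit_block[OF diag xy yx diag])
    define w where "w k p = single x (a k) p - single y (b k) p" for k p
    have ww: "form (w k) (w k) = g x x (star (a k) * a k) + g y y (star (b k) * b k)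
        - 2 * g x y (star (a k) * b k)" for k
      using g_star[of y x "star (a k) * b k"] unfolding w_def
      by (simp add: form_diff_left form_diff_right form_single star_mult star_star)
    have "(\<Sum>k<2. form (w k) (w k)) = g x x (\<kappa> (matrix_unit x x)) + g y y (\<kappa> (matrix_unit y y))
        - 2 * g x y (\<kappa> (matrix_unit x y))"
      unfolding ww ab g_simps by (simp add: sum.distrib sum_subtractf sum_distrib_left)
    also have "\<dots> = 0" by (simp add: g_\<kappa> diag xy entry_matrix_unit)
    finally have "form (w k) (w k) = 0" if "k < 2" for k
      using that sum_nonneg_0[of "{..<2}" "\<lambda>k. form (w k) (w k)" k] form_nonneg by simp
    then have "null (\<lambda>p. \<Sum>k<2. star (a k) * w k p)"
      by (intro null_sum null_mult) (auto simp: null_def)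
    then have 1: "null (\<lambda>p. single x (\<kappa> (matrix_unit x x)) p - single y (\<kappa> (matrix_unit x y)) p)"
      unfolding ab(1) ab(2)
      by (rule null_cong) (simp add: w_def right_diff_distrib sum_subtractf)
    have "null (\<lambda>p. \<Sum>z\<in>UNIV - {x}. single x (\<kappa> (matrix_unit z z)) p)"
      by (intro null_sum off diag) auto
    then have 2: "null (\<lambda>p. single x 1 p - single x (\<kappa> (matrix_unit x x)) p)"
    proof (rule null_cong)
      have "1 = (\<Sum>z\<in>UNIV. \<kappa> (matrix_unit z z))"
        using \<kappa>_sum[of UNIV "\<lambda>z. matrix_unit z z"] diag by (simp add: sum_matrix_unit_diag \<kappa>_1)
      also have "\<dots> = \<kappa> (matrix_unit x x) + (\<Sum>z\<in>UNIV - {x}. \<kappa> (matrix_unit z z))"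
        by (rule sum.remove) auto
      finally have rest: "(\<Sum>z\<in>UNIV - {x}. \<kappa> (matrix_unit z z)) = 1 - \<kappa> (matrix_unit x x)"
        by (metis add_diff_cancel_left')
      show "(\<Sum>z\<in>UNIV - {x}. single x (\<kappa> (matrix_unit z z)) p)
          = single x 1 p - single x (\<kappa> (matrix_unit x x)) p" for p
        by (simp add: rest)
    qed
    have "null (\<lambda>p. 0 - ((single x (\<kappa> (matrix_unit x x)) p - single y (\<kappa> (matrix_unit x y)) p)
        + (single x 1 p - single x (\<kappa> (matrix_unit x x)) p)))"
      by (intro null_diff null_add null_zero 1 2)
    then show ?thesis by (rule null_cong) simp
  qed
  show ?thesis
    unfolding rep_def
  proof
    fix z
    show "null (\<lambda>p. single z (\<kappa> (matrix_unit x y)) p - entry (matrix_unit x y) p z *\<^sub>C 1)"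
    proof (cases "z = y")
      case True
      show ?thesis using on by (rule null_cong) (simp add: True entry_matrix_unit scaleC_one)
    next
      case False
      show ?thesis using off[OF False xy yx] by (rule null_cong) (simp add: False entry_matrix_unit)
    qed
  qed
qed

end

text \<open>
  The represented elements form a \<open>C\<^sup>*\<close>-subalgebra that contains the generators \<open>\<kappa> e\<close>, so
  every element is represented.
\<close>

theorem extension_has_left_inverse_hom:
  fixes \<kappa> :: "'x::finite ell2_op \<Rightarrow> 'b::cstar_algebra"
  assumes R: "sym R" "refl R" and ext: "cstar_extension (operator_system_of R) \<kappa>"
  obtains \<rho> where "star_homomorphism \<rho>" "\<And>e. e \<in> operator_system_of R \<Longrightarrow> \<rho> (\<kappa> e) = e"
proof -
  let ?E = "operator_system_of R"
  have "operator_system ?E" "unital_complete_order_iso_on ?E \<kappa>"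
    using ext by (simp_all add: cstar_extension_def)
  then interpret complete_order_embedding ?E \<kappa> by (rule complete_order_embedding.intro)
  obtain g :: "'x \<Rightarrow> 'x \<Rightarrow> 'b \<Rightarrow> real" where g: "\<And>x y. linear (g x y)"
    "\<And>c. 0 \<le> (\<Sum>x\<in>UNIV. \<Sum>y\<in>UNIV. g x y (star (c x) * c y))"
    "\<And>x y a. g x y (star a) = g y x a"
    "\<And>x y e. e \<in> ?E \<Longrightarrow> g x y (\<kappa> e) = Re (entry e x y)"
    by (rule positive_form_exists) blast
  interpret positive_form ?E \<kappa> g
    by (intro positive_form.intro positive_form_axioms.intro complete_order_embedding_axioms g)
  have unit: "matrix_unit x y \<in> ?E" if "(x, y) \<in> R" for x y
    using that by (auto simp: mem_operator_system_of entry_matrix_unit)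
  have rep\<kappa>: "rep (\<kappa> e) e" if "e \<in> ?E" for e
  proof -
    have "e \<in> ?E \<and> rep (\<kappa> e) e" using that[unfolded operator_system_of_def]
    proof (induction rule: complex_scaling.span_induct_alt)
      case base
      then show ?case by (simp add: \<kappa>_0 rep_0 E_closed)
    next
      case (step c a e)
      then obtain x y where a: "a = matrix_unit x y" "(x, y) \<in> R" by auto
      have "(z, z) \<in> R" "(y, x) \<in> R" for z using R a by (auto dest: symD reflD)
      then have "rep (\<kappa> a) a" unfolding a(1) using a(2) by (intro rep_matrix_unit unit) auto
      moreover have aE: "a \<in> ?E" using unit[OF a(2)] a(1) by simp
      moreover have "e \<in> ?E" "rep (\<kappa> e) e" using step.IH by auto
      ultimately have "rep (c *\<^sub>C \<kappa> a + \<kappa> e) (c *\<^sub>C a + e)" by (intro rep_add rep_scaleC)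
      moreover have "\<kappa> (c *\<^sub>C a + e) = c *\<^sub>C \<kappa> a + \<kappa> e"
        using \<kappa>_add[OF E_closed(4)[OF aE] \<open>e \<in> ?E\<close>] \<kappa>_scaleC[OF aE] by simp
      ultimately show ?case using E_closed(3)[OF E_closed(4)[OF aE] \<open>e \<in> ?E\<close>] by simp
    qed
    then show ?thesis ..
  qed
  have "\<kappa> ` ?E \<subseteq> represented"
  proof
    fix b assume "b \<in> \<kappa> ` ?E"
    then obtain e where e: "b = \<kappa> e" "e \<in> ?E" by auto
    then have "rep b e" "rep (star b) (star e)"
      using rep\<kappa>[OF e(2)] rep\<kappa>[OF E_closed(5)[OF e(2)]] \<kappa>_star[OF e(2)] by simp_all
    then show "b \<in> represented" unfolding represented_iff by blast
  qed
  then have "cstar_subalgebra hull (\<kappa> ` ?E) \<subseteq> represented"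
    by (intro hull_minimal cstar_subalgebra_represented)
  then have "represented = UNIV" using ext by (auto simp: cstar_extension_def)
  then have "star_homomorphism \<rho>" by (rule star_homomorphism_\<rho>)
  then show thesis using rep_unique[OF rep\<kappa>] by (rule that)
qed

section \<open>The matrix algebra as \<open>C\<^sup>*\<close>-envelope\<close>

lemma star_homomorphismD:
  assumes "star_homomorphism \<phi>"
  shows "\<phi> (a + b) = \<phi> a + \<phi> b" "\<phi> (c *\<^sub>C a) = c *\<^sub>C \<phi> a" "\<phi> (a * b) = \<phi> a * \<phi> b"
    "\<phi> (star a) = star (\<phi> a)" "\<phi> (a - b) = \<phi> a - \<phi> b" "\<phi> (r *\<^sub>R a) = r *\<^sub>R \<phi> a" "\<phi> 0 = 0"
proof -
  note h = assms[unfolded star_homomorphism_def]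
  show add: "\<phi> (a + b) = \<phi> a + \<phi> b" for a b using h by blast
  show scale: "\<phi> (c *\<^sub>C a) = c *\<^sub>C \<phi> a" for a c using h by blast
  show "\<phi> (a * b) = \<phi> a * \<phi> b" "\<phi> (star a) = star (\<phi> a)" using h by blast+
  show "\<phi> (a - b) = \<phi> a - \<phi> b" using add[of "a - b" b] by (simp add: algebra_simps)
  show "\<phi> (r *\<^sub>R a) = r *\<^sub>R \<phi> a" by (simp add: scaleR_scaleC scale)
  show "\<phi> 0 = 0" using scale[of 0 0] by simp
qed

lemma linear_star_homomorphism: "star_homomorphism \<phi> \<Longrightarrow> linear \<phi>"
  by (intro linearI) (simp_all add: star_homomorphismD)

lemma entry_star_mult_diag: "entry (star A * A) y y = of_real (\<Sum>z\<in>UNIV. (cmod (entry A z y))\<^sup>2)"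
  by (simp add: entry_mult complex_norm_square mult.commute del: of_real_power)

text \<open>
  A unital homomorphism preserves the identity of \<open>square_dominated\<close>, whose diagonal entries
  bound the columns of \<open>\<phi> b\<close>.
\<close>

lemma bounded_linear_unital_hom_into_matrices:
  fixes \<phi> :: "'b::cstar_algebra \<Rightarrow> 'x::finite ell2_op"
  assumes h: "star_homomorphism \<phi>" and 1: "\<phi> 1 = 1"
  shows "bounded_linear \<phi>"
proof (rule bounded_linear_intro)
  fix b :: 'b
  obtain s :: 'b where s: "star s * s = (2 * (norm b)\<^sup>2) *\<^sub>R 1 - star b * b"
    by (rule square_dominated)
  have "star (\<phi> s) * \<phi> s = (2 * (norm b)\<^sup>2) *\<^sub>R 1 - star (\<phi> b) * \<phi> b"
    using arg_cong[OF s, of \<phi>] by (simp add: star_homomorphismD[OF h] 1)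
  then have "(2 * (norm b)\<^sup>2) *\<^sub>R 1 = star (\<phi> s) * \<phi> s + star (\<phi> b) * \<phi> b" by simp
  then have e: "entry ((2 * (norm b)\<^sup>2) *\<^sub>R 1) y y = entry (star (\<phi> s) * \<phi> s + star (\<phi> b) * \<phi> b) y y" for y
    by simp
  have "cmod (entry (\<phi> b) z y) \<le> sqrt 2 * norm b" for z y
  proof -
    have "of_real (2 * (norm b)\<^sup>2) = (of_real ((\<Sum>z\<in>UNIV. (cmod (entry (\<phi> s) z y))\<^sup>2)
        + (\<Sum>z\<in>UNIV. (cmod (entry (\<phi> b) z y))\<^sup>2)) :: complex)"
      using e[of y] by (simp only: entry_add entry_star_mult_diag entry_scaleR entry_1 if_True refl
          of_real_add scaleR_conv_of_real[where 'a=complex] mult_1_right)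
    then have "2 * (norm b)\<^sup>2 = (\<Sum>z\<in>UNIV. (cmod (entry (\<phi> s) z y))\<^sup>2)
        + (\<Sum>z\<in>UNIV. (cmod (entry (\<phi> b) z y))\<^sup>2)"
      by (simp only: of_real_eq_iff)
    moreover have "(cmod (entry (\<phi> b) z y))\<^sup>2 \<le> (\<Sum>z\<in>UNIV. (cmod (entry (\<phi> b) z y))\<^sup>2)"
      by (rule member_le_sum) auto
    moreover have "0 \<le> (\<Sum>z\<in>UNIV. (cmod (entry (\<phi> s) z y))\<^sup>2)" by (intro sum_nonneg) simp
    ultimately have "(cmod (entry (\<phi> b) z y))\<^sup>2 \<le> (sqrt 2 * norm b)\<^sup>2"
      by (simp add: power_mult_distrib)
    then show ?thesis by (rule power2_le_imp_le) simp
  qed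
  then have "(\<Sum>z\<in>UNIV. \<Sum>y\<in>UNIV. norm (entry (\<phi> b) z y))
      \<le> (\<Sum>z\<in>(UNIV :: 'x set). \<Sum>y\<in>(UNIV :: 'x set). sqrt 2 * norm b)"
    by (intro sum_mono)
  then show "norm (\<phi> b) \<le> norm b * (CARD('x) * (CARD('x) * sqrt 2))"
    using norm_le_entries[of "\<phi> b"] by (simp add: algebra_simps)
qed (simp_all add: star_homomorphismD[OF h])

lemma unital_hom_into_matrices_unique:
  fixes \<phi> \<psi> :: "'b::cstar_algebra \<Rightarrow> 'x::finite ell2_op"
  assumes \<phi>: "star_homomorphism \<phi>" "\<phi> 1 = 1" and \<psi>: "star_homomorphism \<psi>" "\<psi> 1 = 1"
    and agree: "\<And>b. b \<in> G \<Longrightarrow> \<phi> b = \<psi> b" and gen: "cstar_subalgebra hull G = UNIV"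
  shows "\<phi> = \<psi>"
proof -
  have "cstar_subalgebra {b. \<phi> b = \<psi> b}"
    unfolding cstar_subalgebra_def complex_scaling.subspace_def
  proof (intro conjI ballI allI)
    show "closed {b. \<phi> b = \<psi> b}"
      using bounded_linear_unital_hom_into_matrices[OF \<phi>] bounded_linear_unital_hom_into_matrices[OF \<psi>]
      by (intro closed_Collect_eq linear_continuous_on)
  qed (simp_all add: star_homomorphismD[OF \<phi>(1)] star_homomorphismD[OF \<psi>(1)])
  then have "cstar_subalgebra hull G \<subseteq> {b. \<phi> b = \<psi> b}"
    using agree by (intro hull_minimal) auto
  then show ?thesis using gen by auto
qed

lemma rtrancl_UNIV_of_equiv_hull:
  assumes "sym R" "(equiv UNIV hull R) = UNIV"
  shows "R\<^sup>* = UNIV"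
proof -
  have "equiv UNIV (R\<^sup>*)"
    using assms(1) by (intro equivI) (auto intro: refl_rtrancl sym_rtrancl trans_rtrancl)
  then have "(equiv UNIV hull R) \<subseteq> R\<^sup>*" by (intro hull_minimal) auto
  with assms(2) show ?thesis by auto
qed

lemma matrix_units_generate:
  assumes conn: "R\<^sup>* = UNIV" and T: "cstar_subalgebra T" "operator_system_of R \<subseteq> T" "1 \<in> T"
    and R: "refl R"
  shows "T = UNIV"
proof -
  have sub: "csubspace T" and mult: "\<And>a b. a \<in> T \<Longrightarrow> b \<in> T \<Longrightarrow> a * b \<in> T"
    using T(1) by (auto simp: cstar_subalgebra_def)
  have unit: "matrix_unit x y \<in> T" if "(x, y) \<in> R" for x y
    using that T(2) by (auto simp: mem_operator_system_of entry_matrix_unit)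
  have "matrix_unit x y \<in> T" for x y
  proof -
    have "(x, y) \<in> R\<^sup>*" using conn by simp
    then show ?thesis
    proof induction
      case base
      show ?case using R by (intro unit) (simp add: refl_on_def)
    next
      case (step y z)
      then show ?case using mult[OF step.IH unit[OF step.hyps(2)]] by (simp add: matrix_unit_mult)
    qed
  qed
  then have "A \<in> T" for A
    by (subst op_expansion) (intro complex_scaling.subspace_sum[OF sub] complex_scaling.subspace_scale[OF sub])
  then show ?thesis by auto
qed

lemma cstar_extension_identity:
  assumes "sym R" "refl R" "R\<^sup>* = UNIV"
  shows "cstar_extension (operator_system_of R) (\<lambda>a. a)"
proof -
  have "cstar_subalgebra hull (operator_system_of R) = UNIV"
  proof (rule hull_unique)
    show "cstar_subalgebra (UNIV :: 'a ell2_op set)"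
      by (simp add: cstar_subalgebra_def)
    show "UNIV \<subseteq> T" if "operator_system_of R \<subseteq> T" "cstar_subalgebra T" for T
    proof -
      have "1 \<in> T" using operator_system_operator_system_of[OF assms(1,2)] that(1)
        by (auto simp: operator_system_def)
      then show ?thesis using matrix_units_generate[OF assms(3) that(2,1)] assms(2) by simp
    qed
  qed simp
  then show ?thesis
    using operator_system_operator_system_of[OF assms(1,2)]
    by (simp add: cstar_extension_def unital_complete_order_iso_on_def image_ident)
qed

theorem cstar_envelope_operator_system_of:
  fixes R :: "('x::finite \<times> 'x) set"
  assumes R: "sym R" "refl R" "R\<^sup>* = UNIV"
  shows "cstar_envelope TYPE('b::cstar_algebra) (operator_system_of R) (\<lambda>a. a)"
  unfolding cstar_envelope_def
proof (intro conjI allI impI cstar_extension_identity R)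
  fix \<kappa> :: "'x ell2_op \<Rightarrow> 'b"
  assume ext: "cstar_extension (operator_system_of R) \<kappa>"
  obtain \<rho> :: "'b \<Rightarrow> 'x ell2_op" where
    \<rho>: "star_homomorphism \<rho>" "\<And>e. e \<in> operator_system_of R \<Longrightarrow> \<rho> (\<kappa> e) = e"
    by (rule extension_has_left_inverse_hom[OF R(1,2) ext]) blast
  have one: "1 \<in> operator_system_of R" and \<kappa>1: "\<kappa> 1 = 1"
    and gen: "cstar_subalgebra hull (\<kappa> ` operator_system_of R) = UNIV"
    using ext by (auto simp: cstar_extension_def operator_system_def unital_complete_order_iso_on_def)
  show "\<exists>!\<rho>. star_homomorphism \<rho> \<and> (\<forall>x\<in>operator_system_of R. \<rho> (\<kappa> x) = x)"
  proof (rule ex1I[of _ \<rho>])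
    show "star_homomorphism \<rho> \<and> (\<forall>x\<in>operator_system_of R. \<rho> (\<kappa> x) = x)" using \<rho> by blast
    fix \<phi> :: "'b \<Rightarrow> 'x ell2_op"
    assume \<phi>: "star_homomorphism \<phi> \<and> (\<forall>x\<in>operator_system_of R. \<phi> (\<kappa> x) = x)"
    show "\<phi> = \<rho>"
    proof (rule unital_hom_into_matrices_unique[OF _ _ \<rho>(1) _ _ gen])
      show "star_homomorphism \<phi>" using \<phi> by blast
      show "\<phi> 1 = 1" "\<rho> 1 = 1" using \<phi> \<rho>(2)[OF one] one \<kappa>1 by auto
      show "\<phi> b = \<rho> b" if "b \<in> \<kappa> ` operator_system_of R" for b using that \<phi> \<rho>(2) by auto
    qed
  qed
qed

section \<open>Products of elements and walks in the graph\<close>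

lemma relpow_mono_refl:
  assumes "refl R" "m \<le> n"
  shows "R ^^ m \<subseteq> R ^^ n"
  using assms(2)
proof (induction rule: dec_induct)
  case (step k)
  have "R ^^ k \<subseteq> R ^^ Suc k" using assms(1) by (auto simp: refl_on_def)
  with step show ?case by blast
qed simp

lemma operator_system_of_mono: "R \<subseteq> S \<Longrightarrow> operator_system_of R \<subseteq> operator_system_of S"
  unfolding mem_operator_system_of subset_iff by blast

lemma operator_system_of_mult:
  assumes "A \<in> operator_system_of R" "B \<in> operator_system_of S"
  shows "A * B \<in> operator_system_of (R O S)"
  unfolding mem_operator_system_of entry_mult
proof (intro allI impI sum.neutral ballI)
  fix x y z assume "(x, y) \<notin> R O S"
  then have "(x, z) \<notin> R \<or> (z, y) \<notin> S" by auto
  then show "entry A x z * entry B z y = 0"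
    using assms by (auto simp: mem_operator_system_of)
qed

text \<open>
  A matrix unit at the ends of a walk of length \<open>n\<close> is the product of the matrix units along it.
  Reflexivity absorbs shorter products.
\<close>

lemma span_products_operator_system_of:
  assumes R: "refl R" and n: "0 < n"
  shows "cspan {prod_list xs |xs. xs \<noteq> [] \<and> length xs \<le> n \<and> set xs \<subseteq> operator_system_of R}
    = operator_system_of (R ^^ n)" (is "cspan ?P = _")
proof
  have "prod_list xs \<in> operator_system_of (R ^^ length xs)" if "set xs \<subseteq> operator_system_of R" for xs
    using that
  proof (induction xs)
    case Nil
    then show ?case by (simp add: mem_operator_system_of entry_1)
  next
    case (Cons a xs)
    then have "a * prod_list xs \<in> operator_system_of (R O R ^^ length xs)"
      by (intro operator_system_of_mult) auto
    then show ?case by (simp add: relpow_commute)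
  qed
  then have "?P \<subseteq> operator_system_of (R ^^ n)"
    using operator_system_of_mono[OF relpow_mono_refl[OF R]] by blast
  then show "cspan ?P \<subseteq> operator_system_of (R ^^ n)"
    by (rule complex_scaling.span_minimal)
      (simp add: operator_system_of_def complex_scaling.subspace_span)
next
  obtain m where m: "n = Suc m" using n gr0_implies_Suc by blast
  have unit: "matrix_unit x y \<in> operator_system_of R" if "(x, y) \<in> R" for x y
    using that by (auto simp: mem_operator_system_of entry_matrix_unit)
  have walk: "\<exists>xs. length xs = k \<and> set xs \<subseteq> operator_system_of R
      \<and> prod_list xs * matrix_unit y y = matrix_unit x y" if "(x, y) \<in> R ^^ k" for x y k
    using that
  proof (induction k arbitrary: y)
    case 0
    then show ?case by simp
  next
    case (Suc k)
    then obtain z where z: "(x, z) \<in> R ^^ k" "(z, y) \<in> R" by auto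
    with Suc.IH obtain xs where xs: "length xs = k" "set xs \<subseteq> operator_system_of R"
        "prod_list xs * matrix_unit z z = matrix_unit x z"
      by blast
    have "prod_list (xs @ [matrix_unit z y]) * matrix_unit y y
        = (prod_list xs * matrix_unit z z) * matrix_unit z y"
      by (simp add: mult.assoc matrix_unit_mult)
    also have "\<dots> = matrix_unit x y" by (simp add: xs matrix_unit_mult)
    finally show ?case using xs unit[OF z(2)] by (intro exI[of _ "xs @ [matrix_unit z y]"]) simp
  qed
  have "matrix_unit x y \<in> ?P" if xy: "(x, y) \<in> R ^^ n" for x y
  proof -
    obtain z where z: "(x, z) \<in> R ^^ m" "(z, y) \<in> R" using xy m by auto
    with walk obtain xs where xs: "length xs = m" "set xs \<subseteq> operator_system_of R"
        "prod_list xs * matrix_unit z z = matrix_unit x z"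
      by blast
    have "prod_list (xs @ [matrix_unit z y]) = (prod_list xs * matrix_unit z z) * matrix_unit z y"
      by (simp add: mult.assoc matrix_unit_mult)
    also have "\<dots> = matrix_unit x y" by (simp add: xs matrix_unit_mult)
    finally show ?thesis
      using xs unit[OF z(2)] m by (intro CollectI exI[of _ "xs @ [matrix_unit z y]"]) simp
  qed
  then have "{matrix_unit x y |x y. (x, y) \<in> R ^^ n} \<subseteq> ?P" by auto
  then show "operator_system_of (R ^^ n) \<subseteq> cspan ?P"
    unfolding operator_system_of_def[of "R ^^ n"] by (rule complex_scaling.span_mono)
qed

lemma bounded_linear_hom_from_matrices:
  fixes \<phi> :: "'x::finite ell2_op \<Rightarrow> 'c::cstar_algebra"
  assumes h: "star_homomorphism \<phi>"
  shows "bounded_linear \<phi>"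
proof (rule bounded_linear_intro)
  fix A
  have "\<phi> A = (\<Sum>x\<in>UNIV. \<Sum>y\<in>UNIV. entry A x y *\<^sub>C \<phi> (matrix_unit x y))"
    by (subst op_expansion) (simp add: linear_sum[OF linear_star_homomorphism[OF h]] star_homomorphismD[OF h])
  also have "norm \<dots> \<le> (\<Sum>x\<in>UNIV. \<Sum>y\<in>UNIV. norm A * norm (\<phi> (matrix_unit x y)))"
    by (intro sum_norm_le) (simp add: norm_scaleC mult_right_mono norm_entry_le)
  finally show "norm (\<phi> A) \<le> norm A * (\<Sum>x\<in>UNIV. \<Sum>y\<in>UNIV. norm (\<phi> (matrix_unit x y)))"
    by (simp add: sum_distrib_left)
qed (simp_all add: star_homomorphismD[OF h])

text \<open>
  A quantitative form of simplicity of the matrix algebra: \<open>\<Sum>\<^sub>x e\<^sub>x\<^sub>i A e\<^sub>j\<^sub>x\<close> is the scalar \<open>A\<^sub>i\<^sub>j\<close>, whose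
  image has norm \<open>\<bar>A\<^sub>i\<^sub>j\<bar>\<close>.
\<close>

lemma unital_hom_from_matrices_bounded_below:
  fixes \<phi> :: "'x::finite ell2_op \<Rightarrow> 'c::cstar_algebra"
  assumes h: "star_homomorphism \<phi>" and 1: "\<phi> 1 = 1"
  obtains e where "0 < e" "\<And>A. e * norm A \<le> norm (\<phi> A)"
proof -
  define K where "K i j = (\<Sum>x\<in>UNIV. norm (\<phi> (matrix_unit x i)) * norm (\<phi> (matrix_unit j x)))" for i j
  define L where "L = (\<Sum>i\<in>UNIV. \<Sum>j\<in>UNIV. K i j)"
  have L0: "0 \<le> L" unfolding L_def K_def by (intro sum_nonneg mult_nonneg_nonneg) auto
  have entry_le: "cmod (entry A i j) \<le> K i j * norm (\<phi> A)" for A i j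
  proof -
    have "(\<Sum>x\<in>UNIV. matrix_unit x i * A * matrix_unit j x) = entry A i j *\<^sub>C 1"
    proof (rule op_eqI)
      fix p q
      have "entry (matrix_unit x i * A * matrix_unit j x) p q
          = (if x = p then if p = q then entry A i j else 0 else 0)" for x
        by (auto simp: entry_mult entry_matrix_unit if_distrib[where f="\<lambda>t. t * _"]
            if_distrib[where f="\<lambda>t. _ * t"] cong: if_cong)
      then show "entry (\<Sum>x\<in>UNIV. matrix_unit x i * A * matrix_unit j x) p q = entry (entry A i j *\<^sub>C 1) p q"
        by (simp add: entry_sum entry_1)
    qed
    then have "entry A i j *\<^sub>C \<phi> 1 = \<phi> (\<Sum>x\<in>UNIV. matrix_unit x i * A * matrix_unit j x)"
      by (simp add: star_homomorphismD(2)[OF h])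
    also have "\<dots> = (\<Sum>x\<in>UNIV. \<phi> (matrix_unit x i) * \<phi> A * \<phi> (matrix_unit j x))"
      by (simp add: linear_sum[OF linear_star_homomorphism[OF h]] star_homomorphismD(3)[OF h])
    finally have "norm (entry A i j *\<^sub>C (1 :: 'c))
        = norm (\<Sum>x\<in>UNIV. \<phi> (matrix_unit x i) * \<phi> A * \<phi> (matrix_unit j x))"
      by (simp add: 1)
    also have "\<dots> \<le> (\<Sum>x\<in>UNIV. norm (\<phi> (matrix_unit x i)) * norm (\<phi> A) * norm (\<phi> (matrix_unit j x)))"
      by (intro sum_norm_le order_trans[OF norm_mult_ineq] mult_right_mono norm_mult_ineq norm_ge_zero)
    finally have "norm (entry A i j *\<^sub>C (1 :: 'c))
        \<le> (\<Sum>x\<in>UNIV. norm (\<phi> (matrix_unit x i)) * norm (\<phi> A) * norm (\<phi> (matrix_unit j x)))" .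
    then show ?thesis by (simp add: norm_scaleC K_def sum_distrib_left sum_distrib_right mult_ac)
  qed
  have "norm A \<le> L * norm (\<phi> A)" for A
  proof -
    have "norm A \<le> (\<Sum>i\<in>UNIV. \<Sum>j\<in>UNIV. norm (entry A i j))" by (rule norm_le_entries)
    also have "\<dots> \<le> (\<Sum>i\<in>UNIV. \<Sum>j\<in>UNIV. K i j * norm (\<phi> A))" by (intro sum_mono entry_le)
    finally show ?thesis by (simp add: L_def sum_distrib_right)
  qed
  then have "norm A \<le> (L + 1) * norm (\<phi> A)" for A
    by (rule order_trans) (simp add: mult_right_mono)
  then show thesis using L0 by (intro that[of "1 / (L + 1)"]) (simp_all add: field_simps)
qed

lemma closed_operator_system_of: "closed (operator_system_of R)"
proof -
  have "bounded_linear (\<lambda>A :: 'a ell2_op. entry A x y)" for x y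
    by (rule bounded_linear_intro[where K=1]) (simp_all add: norm_entry_le)
  then have "closed {A :: 'a ell2_op. entry A x y = 0}" for x y
    by (intro closed_Collect_eq linear_continuous_on continuous_on_const)
  then have "closed {A :: 'a ell2_op. \<forall>x y. (x, y) \<notin> R \<longrightarrow> entry A x y = 0}"
    by (intro closed_Collect_all closed_Collect_imp open_Collect_const)
  then show ?thesis by (simp add: mem_operator_system_of[symmetric])
qed

text \<open>
  A bounded map that is bounded below preserves completeness.  This identifies the product spaces
  with linear spans of products.
\<close>

lemma closed_image_operator_system_of:
  fixes \<phi> :: "'x::finite ell2_op \<Rightarrow> 'c::cstar_algebra"
  assumes h: "star_homomorphism \<phi>" and 1: "\<phi> 1 = 1"
  shows "closed (\<phi> ` operator_system_of R)"
proof -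
  obtain e where e: "0 < e" "\<And>A. e * norm A \<le> norm (\<phi> A)"
    using unital_hom_from_matrices_bounded_below[OF h 1] by blast
  have "subspace (operator_system_of R)"
    by (auto simp: subspace_def mem_operator_system_of)
  moreover have "complete (operator_system_of R)"
    by (simp add: complete_eq_closed closed_operator_system_of)
  ultimately have "complete (\<phi> ` operator_system_of R)"
    using complete_isometric_image[OF e(1) _ bounded_linear_hom_from_matrices[OF h]] e(2) by blast
  then show ?thesis by (rule complete_imp_closed)
qed

lemma prod_list_image:
  assumes h: "star_homomorphism \<phi>" and 1: "\<phi> 1 = 1"
  shows "prod_list (map \<phi> xs) = \<phi> (prod_list xs)"
  by (induction xs) (simp_all add: star_homomorphismD[OF h] 1)

lemma span_image:
  assumes h: "star_homomorphism \<phi>"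
  shows "cspan (\<phi> ` S) = \<phi> ` cspan S"
proof
  show "cspan (\<phi> ` S) \<subseteq> \<phi> ` cspan S"
  proof (rule complex_scaling.span_minimal)
    show "\<phi> ` S \<subseteq> \<phi> ` cspan S" by (intro image_mono complex_scaling.span_superset)
    show "csubspace (\<phi> ` cspan S)"
      unfolding complex_scaling.subspace_def
    proof (intro conjI ballI allI)
      show "0 \<in> \<phi> ` cspan S"
        using complex_scaling.span_zero star_homomorphismD(7)[OF h] by (metis image_eqI)
      show "a + b \<in> \<phi> ` cspan S" if "a \<in> \<phi> ` cspan S" "b \<in> \<phi> ` cspan S" for a b
        using that by (auto simp: star_homomorphismD(1)[OF h, symmetric] intro!: imageI complex_scaling.span_add)
      show "c *\<^sub>C a \<in> \<phi> ` cspan S" if "a \<in> \<phi> ` cspan S" for a c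
        using that by (auto simp: star_homomorphismD(2)[OF h, symmetric] intro!: imageI complex_scaling.span_scale)
    qed
  qed
  have "cspan S \<subseteq> {a. \<phi> a \<in> cspan (\<phi> ` S)}"
  proof (rule complex_scaling.span_minimal)
    show "S \<subseteq> {a. \<phi> a \<in> cspan (\<phi> ` S)}" by (auto intro: complex_scaling.span_base)
    show "csubspace {a. \<phi> a \<in> cspan (\<phi> ` S)}"
      unfolding complex_scaling.subspace_def
      by (auto simp: star_homomorphismD[OF h] intro: complex_scaling.span_zero
          complex_scaling.span_add complex_scaling.span_scale)
  qed
  then show "\<phi> ` cspan S \<subseteq> cspan (\<phi> ` S)" by auto
qed

lemma product_space_image:
  fixes \<phi> :: "'x::finite ell2_op \<Rightarrow> 'c::cstar_algebra"
  assumes h: "star_homomorphism \<phi>" and 1: "\<phi> 1 = 1" and R: "refl R" and n: "0 < n"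
  shows "product_space (\<phi> ` operator_system_of R) n = \<phi> ` operator_system_of (R ^^ n)"
proof -
  let ?E = "operator_system_of R"
  have "{prod_list xs |xs. xs \<noteq> [] \<and> length xs \<le> n \<and> set xs \<subseteq> \<phi> ` ?E}
      = \<phi> ` {prod_list xs |xs. xs \<noteq> [] \<and> length xs \<le> n \<and> set xs \<subseteq> ?E}" (is "?L = ?M")
  proof
    show "?L \<subseteq> ?M"
    proof
      fix a assume "a \<in> ?L"
      then obtain ys where ys: "a = prod_list ys" "ys \<noteq> []" "length ys \<le> n" "set ys \<subseteq> \<phi> ` ?E"
        by auto
      have "ys \<in> lists (\<phi> ` ?E)" using ys(4) by auto
      then obtain xs where "xs \<in> lists ?E" "ys = map \<phi> xs" unfolding lists_image by auto
      then show "a \<in> ?M" using ys by (auto simp: prod_list_image[OF h 1] intro!: imageI)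
    qed
    show "?M \<subseteq> ?L"
    proof
      fix a assume "a \<in> ?M"
      then obtain xs where xs: "a = \<phi> (prod_list xs)" "xs \<noteq> []" "length xs \<le> n" "set xs \<subseteq> ?E"
        by auto
      then show "a \<in> ?L"
        by (intro CollectI exI[of _ "map \<phi> xs"]) (auto simp: prod_list_image[OF h 1])
    qed
  qed
  then show ?thesis
    unfolding product_space_def
    by (simp add: span_image[OF h] span_products_operator_system_of[OF R n]
        closed_image_operator_system_of[OF h 1] closure_closed)
qed

text \<open>
  Being an algebra, for the span of the matrix units over \<open>R ^^ n\<close>, means transitivity of
  \<open>R ^^ n\<close>.  This relation contains \<open>R\<close> and the diagonal, so by transitivity it contains all of \<open>R\<^sup>*\<close>.
\<close>

lemma cstar_subalgebra_product_space_iff: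
  fixes \<phi> :: "'x::finite ell2_op \<Rightarrow> 'c::cstar_algebra"
  assumes h: "star_homomorphism \<phi>" and 1: "\<phi> 1 = 1" and R: "refl R" and conn: "R\<^sup>* = UNIV"
    and n: "0 < n"
  shows "cstar_subalgebra (product_space (\<phi> ` operator_system_of R) n) \<longleftrightarrow> R ^^ n = UNIV"
  unfolding product_space_image[OF h 1 R n]
proof
  assume alg: "cstar_subalgebra (\<phi> ` operator_system_of (R ^^ n))"
  obtain e where e: "0 < e" "\<And>A. e * norm A \<le> norm (\<phi> A)"
    using unital_hom_from_matrices_bounded_below[OF h 1] by blast
  have inj: "A = B" if "\<phi> A = \<phi> B" for A B
  proof -
    have "e * norm (A - B) \<le> 0" using e(2)[of "A - B"] that by (simp add: star_homomorphismD[OF h])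
    then show ?thesis using e(1) by (simp add: mult_le_0_iff)
  qed
  have unit_iff: "matrix_unit x y \<in> operator_system_of (R ^^ n) \<longleftrightarrow> (x, y) \<in> R ^^ n" for x y
    by (auto simp: mem_operator_system_of entry_matrix_unit)
  have tr: "trans (R ^^ n)"
  proof (rule transI)
    fix x y z assume "(x, y) \<in> R ^^ n" "(y, z) \<in> R ^^ n"
    then have "\<phi> (matrix_unit x y) * \<phi> (matrix_unit y z) \<in> \<phi> ` operator_system_of (R ^^ n)"
      using alg unit_iff by (auto simp: cstar_subalgebra_def)
    then have "\<phi> (matrix_unit x z) \<in> \<phi> ` operator_system_of (R ^^ n)"
      by (simp add: star_homomorphismD(3)[OF h, symmetric] matrix_unit_mult)
    then have "matrix_unit x z \<in> operator_system_of (R ^^ n)" using inj by (metis imageE)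
    then show "(x, z) \<in> R ^^ n" by (simp add: unit_iff)
  qed
  have sub: "R \<subseteq> R ^^ n" and id: "Id \<subseteq> R ^^ n"
    using relpow_mono_refl[OF R, of 1 n] relpow_mono_refl[OF R, of 0 n] n by simp_all
  have "(x, y) \<in> R ^^ n" if "(x, y) \<in> R\<^sup>*" for x y
    using that
  proof induction
    case base
    show ?case using id by auto
  next
    case (step y z)
    then show ?case using sub transD[OF tr] by blast
  qed
  then show "R ^^ n = UNIV" using conn by auto
next
  assume "R ^^ n = UNIV"
  then have U: "operator_system_of (R ^^ n) = UNIV" by (auto simp: mem_operator_system_of)
  have cl: "closed (range \<phi>)"
    using closed_image_operator_system_of[OF h 1, of UNIV] U \<open>R ^^ n = UNIV\<close> by simp
  show "cstar_subalgebra (\<phi> ` operator_system_of (R ^^ n))"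
    unfolding U cstar_subalgebra_def complex_scaling.subspace_def
  proof (intro conjI ballI allI cl)
    show "0 \<in> range \<phi>" using star_homomorphismD(7)[OF h] by (metis rangeI)
  qed (auto simp: star_homomorphismD(1,2,3,4)[OF h, symmetric])
qed

lemma graph_distance_le_iff:
  assumes "refl R"
  shows "graph_distance R x y \<le> enat n \<longleftrightarrow> (x, y) \<in> R ^^ n"
proof
  assume "(x, y) \<in> R ^^ n"
  then show "graph_distance R x y \<le> enat n" unfolding graph_distance_def by (intro INF_lower) simp
next
  assume le: "graph_distance R x y \<le> enat n"
  show "(x, y) \<in> R ^^ n"
  proof (rule ccontr)
    assume "(x, y) \<notin> R ^^ n"
    then have "Suc n \<le> m" if "(x, y) \<in> R ^^ m" for m
      using that relpow_mono_refl[OF assms, of m n] by (meson not_less_eq_eq subsetD)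
    then have "enat (Suc n) \<le> graph_distance R x y"
      unfolding graph_distance_def by (intro INF_greatest) simp
    with le have "enat (Suc n) \<le> enat n" by (rule order_trans[rotated])
    then show False by simp
  qed
qed

lemma graph_diameter_le_iff:
  fixes R :: "('x::finite \<times> 'x) set"
  assumes "refl R"
  shows "graph_diameter R \<le> enat n \<longleftrightarrow> R ^^ n = UNIV"
proof -
  have "{graph_distance R x y |x y. True} = (\<lambda>(x, y). graph_distance R x y) ` UNIV" by auto
  then have "finite {graph_distance R x y |x y. True}" by simp
  then have "graph_diameter R \<le> enat n \<longleftrightarrow> (\<forall>x y. graph_distance R x y \<le> enat n)"
    unfolding graph_diameter_def by (subst Max_le_iff) auto
  then show ?thesis using graph_distance_le_iff[OF assms] by auto
qed

text \<open>
  The map \<open>\<phi>\<close> is the identity in the standard envelope; in another envelope \<open>\<iota>\<close>, it is the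
  homomorphism provided by the universal property of \<open>\<iota>\<close>.  With a single vertex the diameter
  would be \<open>0\<close>, but the propagation number is at least \<open>1\<close>.
\<close>

theorem propagation_number_eq_graph_diameter:
  fixes \<phi> :: "'x::finite ell2_op \<Rightarrow> 'c::cstar_algebra"
  assumes h: "star_homomorphism \<phi>" and 1: "\<phi> 1 = 1" and R: "refl R" "R\<^sup>* = UNIV"
    and card: "2 \<le> CARD('x)" and \<iota>: "\<And>e. e \<in> operator_system_of R \<Longrightarrow> \<iota> e = \<phi> e"
  shows "propagation_number (operator_system_of R) \<iota> = graph_diameter R"
proof -
  have "\<iota> ` operator_system_of R = \<phi> ` operator_system_of R" using \<iota> by auto
  then have number: "propagation_number (operator_system_of R) \<iota>
      = (INF n\<in>{n. 0 < n \<and> graph_diameter R \<le> enat n}. enat n)"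
    unfolding propagation_number_def
    using cstar_subalgebra_product_space_iff[OF h 1 R] graph_diameter_le_iff[OF R(1)]
    by (simp cong: conj_cong)
  \<comment> \<open>Finiteness of the diameter.\<close>
  have "R\<^sup>* \<subseteq> R ^^ card R"
    using rtrancl_finite_eq_relpow[of R] relpow_mono_refl[OF R(1)] by auto
  then have "graph_diameter R \<le> enat (card R)" using R by (auto simp: graph_diameter_le_iff)
  then obtain d where d: "graph_diameter R = enat d" using enat_ile by blast
  have "d \<noteq> 0"
  proof
    assume "d = 0"
    then have "R ^^ 0 = UNIV" using d graph_diameter_le_iff[OF R(1), of 0] by simp
    then have "x = y" for x y :: 'x by auto
    then have "CARD('x) \<le> 1" by (metis card_le_Suc0_iff_eq finite One_nat_def)
    then show False using card by simp
  qed
  then show ?thesis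
    unfolding number d by (intro antisym INF_lower INF_greatest) auto
qed

theorem proposition3p7:
  fixes R :: "('x::finite \<times> 'x) set"
  assumes "sym R" and "refl R"
    and "(equiv UNIV hull R) = UNIV"
  shows "cstar_envelope TYPE('b::cstar_algebra) (operator_system_of R) (\<lambda>a. a) \<and>
    (2 \<le> CARD('x) \<longrightarrow>
      propagation_number (operator_system_of R) (\<lambda>a. a) = graph_diameter R \<and>
      (\<forall>\<iota> :: 'x ell2_op \<Rightarrow> 'c::cstar_algebra.
        cstar_envelope TYPE('x ell2_op) (operator_system_of R) \<iota> \<longrightarrow>
        propagation_number (operator_system_of R) \<iota> = graph_diameter R))"
proof (intro conjI impI allI)
  have conn: "R\<^sup>* = UNIV" by (rule rtrancl_UNIV_of_equiv_hull[OF assms(1,3)])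
  show "cstar_envelope TYPE('b) (operator_system_of R) (\<lambda>a. a)"
    by (rule cstar_envelope_operator_system_of[OF assms(1,2) conn])
  assume card: "2 \<le> CARD('x)"
  show "propagation_number (operator_system_of R) (\<lambda>a. a) = graph_diameter R"
    by (rule propagation_number_eq_graph_diameter[of "\<lambda>a. a"])
      (simp_all add: star_homomorphism_def assms(2) conn card)
  fix \<iota> :: "'x ell2_op \<Rightarrow> 'c"
  assume env: "cstar_envelope TYPE('x ell2_op) (operator_system_of R) \<iota>"
  then obtain \<rho> :: "'x ell2_op \<Rightarrow> 'c" where
    \<rho>: "star_homomorphism \<rho>" "\<And>e. e \<in> operator_system_of R \<Longrightarrow> \<rho> e = \<iota> e"
    using cstar_extension_identity[OF assms(1,2) conn] unfolding cstar_envelope_def by blast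
  have "\<iota> 1 = 1" "1 \<in> operator_system_of R"
    using env by (auto simp: cstar_envelope_def cstar_extension_def operator_system_def
        unital_complete_order_iso_on_def)
  then show "propagation_number (operator_system_of R) \<iota> = graph_diameter R"
    using \<rho> by (intro propagation_number_eq_graph_diameter[OF \<rho>(1)] assms(2) conn card) auto
qed

end
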